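(* Let $0<\alpha<1$ and let $f_{t,\alpha}$ be the stable Lévy distribution. Then $$\int_0^\infty\frac{r^n}{n!}e^{-r}f_{t,\alpha}(r)\,dr=e^{-t}p_{n;\alpha}(t),\qquad t>0,\ n\in\{0,1,2,\dots\},$$ $$\int_0^\infty I_0(2\sqrt{rs})\,e^{-r}f_{t,\alpha}(r)\,dr=e^{-t}\sum_{n=0}^\infty p_{n;\alpha}(t)\frac{s^n}{n!},\qquad t>0,\ s\in\mathbb{C}.$$ In particular, $p_{n;\alpha}(t)\ge0$ for $0<\alpha<1$ and $t>0$, and, for $n\ge1$, $$\frac{1}{\sqrt{\pi}}\int_0^\infty r^{n-\frac32}e^{-r\left(1+\frac{t^2}{4r^2}\right)}\,dr=\frac{e^{-t}}{2^{n-1}}\,\theta_{n-1}(t),\qquad t\in\mathbb{C}.$$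
   Context: For $0<\alpha<1$, the stable Lévy distribution is $$f_{t,\alpha}(r)=\frac{1}{2\pi i}\int_{\sigma-i\infty}^{\sigma+i\infty}e^{zr-tz^\alpha}\,dz,\qquad\sigma>0,\ t>0,\ r\ge0,$$ where the branch of $z^\alpha$ is chosen so that $\operatorname{Re}(z^\alpha)>0$ whenever $\operatorname{Re}z>0$. The falling factorial is $(z)_n=z(z-1)\cdots(z-n+1)$ for $n\ge1$. For $a\in\mathbb{C}$, the array $(b_{j,n;a})_{n\ge1,\,1\le j\le n}$ is defined by $b_{1,n;a}=(a)_n$, $b_{n,n;a}=a^n$ for $n\ge1$, and $b_{j,n+1;a}=(aj-n)b_{j,n;a}+a\,b_{j-1,n;a}$ for $2\le j\le n$. The polynomials $p_{n;a}$ are $p_{0;a}(t)=1$ and $p_{n;a}(t)=\frac{(-1)^n}{n!}\sum_{l=1}^n b_{l,n;a}(-t)^l$ for $n\ge1$. $I_0$ is the modified Bessel function, $I_0(2z)=\sum_{n=0}^\infty\frac{z^{2n}}{(n!)^2}$. The reverse Bessel polynomial of order $n\ge0$ is $\theta_n(t)=\sum_{k=0}^n a(n,n-k)t^k$, where $a(n,j)=\frac{(n+j)!}{2^j(n-j)!\,j!}$ for $0\le j\le n$.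
   Formalization: The last identity is proved for complex t with |Im t| ≤ Re t instead of all t in C: for Re(t²) < 0 the integral diverges, and for Re t < 0 it fails (n = 1, t = −1 gives e^{-1} on the left, e on the right), the left side being even in t. *)

theory Defs
  imports "HOL-Analysis.Analysis"
begin

definition vertical_line_integral :: "real \<Rightarrow> (complex \<Rightarrow> complex) \<Rightarrow> complex" where
  "vertical_line_integral \<sigma> g = (LBINT y. g (Complex \<sigma> y) * \<i>)"

text \<open>
  The abscissa \<open>\<sigma>\<close> of the path of integration is kept as a parameter; results about the stable
  Levy distribution are to hold for every \<open>\<sigma> > 0\<close>.  For \<open>0 < \<alpha> < 1\<close> the principal branch
  \<open>z powr \<alpha> = exp (\<alpha> * Ln z)\<close> is the one with \<open>Re (z powr \<alpha>) > 0\<close> whenever \<open>Re z > 0\<close>.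
\<close>

definition stable_levy :: "real \<Rightarrow> real \<Rightarrow> real \<Rightarrow> real \<Rightarrow> complex" where
  "stable_levy \<sigma> t \<alpha> r =
     1 / (2 * of_real pi * \<i>) *
     vertical_line_integral \<sigma> (\<lambda>z. exp (z * of_real r - of_real t * z powr of_real \<alpha>))"

definition falling_fact :: "complex \<Rightarrow> nat \<Rightarrow> complex" where
  "falling_fact z n = (\<Prod>i<n. z - of_nat i)"

text \<open>
  \<open>b_coeff a j n\<close> is $b_{j,n;a}$; the array lives on \<open>1 \<le> j \<le> n\<close>, and outside this range
  the value is set to \<open>0\<close> by convention.
\<close>

fun b_coeff :: "complex \<Rightarrow> nat \<Rightarrow> nat \<Rightarrow> complex" where
  "b_coeff a j 0 = 0"
| "b_coeff a j (Suc n) =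
     (if j = 0 \<or> j > Suc n then 0
      else if j = 1 then falling_fact a (Suc n)
      else if j = Suc n then a ^ Suc n
      else (a * of_nat j - of_nat n) * b_coeff a j n + a * b_coeff a (j - 1) n)"

definition p_poly :: "nat \<Rightarrow> complex \<Rightarrow> complex \<Rightarrow> complex" where
  "p_poly n a t =
     (if n = 0 then 1 else (- 1) ^ n / fact n * (\<Sum>l=1..n. b_coeff a l n * (- t) ^ l))"

text \<open>Normalised so that \<open>bessel_I0 (2 * z) = (\<Sum>n. z ^ (2 * n) / (fact n)\<^sup>2)\<close>.\<close>

definition bessel_I0 :: "complex \<Rightarrow> complex" where
  "bessel_I0 w = (\<Sum>n. (w / 2) ^ (2 * n) / (fact n)\<^sup>2)"

definition bessel_coeff :: "nat \<Rightarrow> nat \<Rightarrow> complex" where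
  "bessel_coeff n j = fact (n + j) / (2 ^ j * fact (n - j) * fact j)"

definition reverse_bessel :: "nat \<Rightarrow> complex \<Rightarrow> complex" where
  "reverse_bessel n t = (\<Sum>k=0..n. bessel_coeff n (n - k) * t ^ k)"

end

theory Submission
  imports Defs "HOL-Probability.Sinc_Integral" "HOL-Complex_Analysis.Complex_Analysis"
begin

text \<open>
  The density \<open>f\<close> is the inverse Laplace transform of \<open>g z = exp (- t z powr \<alpha>)\<close>. The argument of
  \<open>z powr \<alpha>\<close> stays below \<open>\<pi> \<alpha> / 2 < \<pi> / 2\<close> in the right half-plane, so \<open>g\<close> decays like a stretched
  exponential along vertical lines; this makes every integral absolutely convergent and lets the line
  of integration be moved freely by the residue theorem (\<open>vertical_line_integral_diff_residue\<close>). In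
  particular \<open>f\<close> does not depend on the abscissa, and on the line \<open>Re z = 1/2\<close> one reads off
  \<open>|f r| \<le> C exp (r / 2)\<close>, which the weight \<open>exp (- r)\<close> beats.

  By Fubini the \<open>n\<close>-th moment of \<open>exp (- r) f r\<close>, divided by \<open>n!\<close>, is the line integral of
  \<open>g z / (1 - z) ^ (n + 1)\<close> over \<open>2 \<pi> \<i>\<close>. Pushing the line to the right across the pole at \<open>1\<close> evaluates it as
  \<open>(- 1) ^ n / n!\<close> times the \<open>n\<close>-th derivative of \<open>g\<close> at \<open>1\<close> (\<open>moment_stable_levy\<close>), and the array \<open>b\<close> is
  made so that this is \<open>exp (- t) * p\<^sub>n t\<close> (\<open>higher_deriv_eq_p_poly\<close>). The second formula follows by integrating
  the power series of \<open>I\<^sub>0\<close> term by term (\<open>bessel_moment_stable_levy\<close>). Nonnegativity of \<open>p\<^sub>n t\<close> is visible on the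
  coefficients, whose signs alternate in a checkerboard pattern for \<open>0 < \<alpha> < 1\<close> (\<open>b_coeff_sign\<close>).

  For the last formula, completing the square shows that \<open>exp (- r - t\<^sup>2 / (4 r))\<close> equals
  \<open>exp (\<plusminus> t)\<close> times a Gaussian in \<open>sqrt r \<plusminus> t / (2 sqrt r)\<close>; a primitive of the Gaussian therefore evaluates the
  integrals with exponents \<open>- 1/2\<close> and \<open>- 3/2\<close> directly for all complex \<open>t\<close> in the open sector \<open>|Im t| < Re t\<close>
  (\<open>bessel_integral_base\<close>). Integration by parts gives a three-term recurrence in the exponent, which is that of the
  reverse Bessel polynomials (\<open>bessel_integral_rec\<close>, \<open>reverse_bessel_rec\<close>), and dominated convergence
  carries the result to the boundary of the sector.
\<close>

section \<open>The polynomials \<open>p\<^sub>n\<close>\<close>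

lemma b_coeff_outside: "l = 0 \<or> l > n \<Longrightarrow> b_coeff a l n = 0"
  by (cases n) auto

text \<open>
  The recurrence that defines the array in its interior also produces its first column and its
  diagonal once the entries outside the triangle are \<open>0\<close>;
  one identity then covers all \<open>n \<ge> 1\<close> and \<open>l \<ge> 1\<close>.
\<close>

lemma b_coeff_Suc:
  assumes "n \<ge> 1" "l \<ge> 1"
  shows "b_coeff a l (Suc n) = (a * of_nat l - of_nat n) * b_coeff a l n + a * b_coeff a (l - 1) n"
proof -
  consider "l = 1" | "l = Suc n" "l \<noteq> 1" | "l > Suc n" | "1 < l" "l < Suc n"
    using assms by linarith
  then show ?thesis
  proof cases
    case 1
    have "b_coeff a 1 n = falling_fact a n"
      using assms(1) by (cases n) auto
    then show ?thesis
      using 1 assms(1) b_coeff_outside[of 0 n a] by (simp add: falling_fact_def)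
  next
    case 2
    have "b_coeff a n n = a ^ n"
      using assms(1) by (cases n) (auto simp: falling_fact_def)
    then show ?thesis using 2 assms(1) b_coeff_outside[of "Suc n" n a] by simp
  next
    case 3
    then show ?thesis using b_coeff_outside[of l n a] b_coeff_outside[of "l-1" n a] by simp
  qed simp
qed

text \<open>
  In the recurrence the factor \<open>\<alpha> l - n\<close> is negative for \<open>1 \<le> l \<le> n\<close> because \<open>\<alpha> < 1\<close>, while
  \<open>\<alpha> > 0\<close>. Hence raising \<open>n\<close> with \<open>l\<close> fixed flips the sign, and raising both keeps it: the signs form
  a checkerboard.
\<close>

lemma b_coeff_sign:
  fixes \<alpha> :: real
  assumes "0 < \<alpha>" "\<alpha> < 1"
  shows "(-1) ^ (n + l) * b_coeff (of_real \<alpha>) l n \<in> \<real>\<^sub>\<ge>\<^sub>0"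
proof (induction n arbitrary: l)
  case 0
  then show ?case by simp
next
  case (Suc n)
  consider "n = 0" "l = 1" | "l = 0 \<or> l > Suc n" | "n \<ge> 1" "l \<ge> 1" "l \<le> Suc n" by linarith
  then show ?case
  proof cases
    case 1
    then show ?thesis using assms by (simp add: falling_fact_def)
  next
    case 2
    then show ?thesis using b_coeff_outside[of l "Suc n"] by simp
  next
    case 3
    define x y where "x = (-1) ^ (n + l) * b_coeff (of_real \<alpha>) l n"
      and "y = (-1) ^ (n + (l - 1)) * b_coeff (of_real \<alpha>) (l - 1) n"
    have xy: "x \<in> \<real>\<^sub>\<ge>\<^sub>0" "y \<in> \<real>\<^sub>\<ge>\<^sub>0"
      unfolding x_def y_def using Suc.IH by blast+
    have eq: "(-1) ^ (Suc n + l) * b_coeff (of_real \<alpha>) l (Suc n) =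
          of_real (real n - \<alpha> * real l) * x + of_real \<alpha> * y"
      using 3 by (cases l) (simp_all only: b_coeff_Suc x_def y_def, simp_all add: algebra_simps)
    show ?thesis
    proof (cases "l \<le> n")
      case True
      have "\<alpha> * real l \<le> 1 * real n"
        using True assms by (intro mult_mono) auto
      then show ?thesis
        unfolding eq using xy assms
        by (intro nonneg_Reals_add_I nonneg_Reals_mult_I) (auto simp: complex_nonneg_Reals_iff)
    next
      case False
      then have "x = 0" using 3 b_coeff_outside[of l n] by (simp add: x_def)
      then show ?thesis
        unfolding eq using xy assms
        by (auto intro!: nonneg_Reals_mult_I simp: complex_nonneg_Reals_iff)
    qed
  qed
qed

lemma sum_in_nonneg_Reals:
  "(\<And>x. x \<in> A \<Longrightarrow> f x \<in> \<real>\<^sub>\<ge>\<^sub>0) \<Longrightarrow> sum f A \<in> \<real>\<^sub>\<ge>\<^sub>0"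
  by (induction A rule: infinite_finite_induct) (auto intro: nonneg_Reals_add_I)

text \<open>
  The checkerboard of signs cancels exactly against \<open>(- 1) ^ n\<close> and \<open>(- t) ^ l\<close>, so that \<open>p\<^sub>n\<close> has
  nonnegative coefficients.
\<close>

lemma p_poly_nonneg:
  fixes \<alpha> t :: real
  assumes "0 < \<alpha>" "\<alpha> < 1" "0 < t"
  shows "p_poly n (of_real \<alpha>) (of_real t) \<in> \<real>\<^sub>\<ge>\<^sub>0"
proof (cases "n = 0")
  case False
  have *: "(\<Sum>l=1..n. ((-1) ^ (n + l) * b_coeff (of_real \<alpha>) l n) * of_real t ^ l) \<in> \<real>\<^sub>\<ge>\<^sub>0"
    using assms(3)
    by (intro sum_in_nonneg_Reals nonneg_Reals_mult_I nonneg_Reals_pow_I b_coeff_sign[OF assms(1,2)]) auto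
  have "p_poly n (of_real \<alpha>) (of_real t) =
     of_real (1 / fact n) * (\<Sum>l=1..n. ((-1) ^ (n + l) * b_coeff (of_real \<alpha>) l n) * of_real t ^ l)"
    using False
    by (simp add: p_poly_def sum_distrib_left power_add mult_ac power_minus[of "complex_of_real t"])
  moreover have "complex_of_real (1 / fact n) \<in> \<real>\<^sub>\<ge>\<^sub>0"
    by (simp only: nonneg_Reals_of_real_iff) simp
  ultimately show ?thesis
    using * by (simp only: nonneg_Reals_mult_I)
qed (simp add: p_poly_def)

text \<open>
  Differentiating \<open>z powr (\<alpha> l - n)\<close> contributes the factor \<open>\<alpha> l - n\<close>, and differentiating the
  exponential shifts \<open>l\<close> by one with a factor \<open>- t \<alpha>\<close>; together these are the recurrence of the array.
\<close>

lemma higher_deriv_exp_powr: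
  fixes \<alpha> t :: complex
  assumes "Re z > 0"
  shows "(deriv ^^ Suc n) (\<lambda>z. exp (- t * z powr \<alpha>)) z =
    exp (- t * z powr \<alpha>) *
      (\<Sum>l=1..Suc n. b_coeff \<alpha> l (Suc n) * (- t) ^ l * z powr (of_nat l * \<alpha> - of_nat (Suc n)))"
  using assms
proof (induction n arbitrary: z)
  case 0
  have "z \<notin> \<real>\<^sub>\<le>\<^sub>0" using 0 by (auto simp: complex_nonpos_Reals_iff)
  then have "((\<lambda>z. exp (- t * z powr \<alpha>)) has_field_derivative
     exp (- t * z powr \<alpha>) * (- t * (\<alpha> * z powr (\<alpha> - 1)))) (at z)"
    by (auto intro!: derivative_eq_intros)
  then show ?case
    by (simp add: DERIV_imp_deriv falling_fact_def)
next
  case (Suc n)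
  define N where "N = Suc n"
  define c where "c l = b_coeff \<alpha> l N * (- t) ^ l" for l
  define G where "G = (\<lambda>z. exp (- t * z powr \<alpha>) *
      (\<Sum>l=1..N. c l * z powr (of_nat l * \<alpha> - of_nat N)))"
  have nz: "z \<notin> \<real>\<^sub>\<le>\<^sub>0" "z \<noteq> 0" using Suc.prems by (auto simp: complex_nonpos_Reals_iff)
  have op: "open {z. Re z > 0}" by (rule open_halfspace_Re_gt)
  have ev: "\<forall>\<^sub>F w in nhds z. (deriv ^^ N) (\<lambda>z. exp (- t * z powr \<alpha>)) w = G w"
    using Suc.prems op Suc.IH by (auto simp: eventually_nhds G_def N_def c_def intro!: exI[of _ "{z. Re z > 0}"])
  let ?p = "\<lambda>x. z powr x" let ?e = "exp (- t * z powr \<alpha>)"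
  have "(G has_field_derivative
     ?e * (- t * (\<alpha> * z powr (\<alpha> - 1))) * (\<Sum>l=1..N. c l * z powr (of_nat l * \<alpha> - of_nat N)) +
     ?e * (\<Sum>l=1..N. c l * ((of_nat l * \<alpha> - of_nat N) * z powr (of_nat l * \<alpha> - of_nat N - 1)))) (at z)"
    unfolding G_def using nz by (auto intro!: derivative_eq_intros sum.cong simp: algebra_simps)
  then have "deriv G z = ?e *
    ((\<Sum>l=1..N. (- t) * \<alpha> * c l * (z powr (\<alpha> - 1) * z powr (of_nat l * \<alpha> - of_nat N))) +
     (\<Sum>l=1..N. c l * (of_nat l * \<alpha> - of_nat N) * z powr (of_nat l * \<alpha> - of_nat N - 1)))"
    by (simp add: DERIV_imp_deriv sum_distrib_left algebra_simps)
  also have "(\<Sum>l=1..N. (- t) * \<alpha> * c l * (z powr (\<alpha> - 1) * z powr (of_nat l * \<alpha> - of_nat N))) =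
     (\<Sum>l=1..N. \<alpha> * b_coeff \<alpha> l N * (- t) ^ Suc l * z powr (of_nat (Suc l) * \<alpha> - of_nat (Suc N)))"
    using nz by (intro sum.cong) (auto simp: c_def powr_add[symmetric] algebra_simps)
  also have "\<dots> = (\<Sum>l=Suc 1..Suc N. \<alpha> * b_coeff \<alpha> (l - 1) N * (- t) ^ l * z powr (of_nat l * \<alpha> - of_nat (Suc N)))"
    by (subst sum.shift_bounds_cl_Suc_ivl) simp
  also have "\<dots> = (\<Sum>l=1..Suc N. \<alpha> * b_coeff \<alpha> (l - 1) N * (- t) ^ l * z powr (of_nat l * \<alpha> - of_nat (Suc N)))"
    using b_coeff_outside[of 0 N \<alpha>] by (intro sum.mono_neutral_left) (auto simp: not_le less_Suc_eq_le)
  also have "(\<Sum>l=1..N. c l * (of_nat l * \<alpha> - of_nat N) * z powr (of_nat l * \<alpha> - of_nat N - 1)) =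
     (\<Sum>l=1..Suc N. (\<alpha> * of_nat l - of_nat N) * b_coeff \<alpha> l N * (- t) ^ l * z powr (of_nat l * \<alpha> - of_nat (Suc N)))"
    using b_coeff_outside[of "Suc N" N \<alpha>] by (auto simp: c_def algebra_simps intro!: sum.cong)
  finally have "deriv G z = ?e *
     (\<Sum>l=1..Suc N. b_coeff \<alpha> l (Suc N) * (- t) ^ l * z powr (of_nat l * \<alpha> - of_nat (Suc N)))"
    by (simp only: sum.distrib[symmetric])
       (auto intro!: sum.cong simp: b_coeff_Suc N_def ring_distribs simp del: b_coeff.simps of_nat_Suc power_Suc)
  moreover have "(deriv ^^ Suc N) (\<lambda>z. exp (- t * z powr \<alpha>)) z = deriv G z"
    using deriv_cong_ev[OF ev refl] by simp
  ultimately show ?case by (simp add: N_def)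
qed

lemma higher_deriv_eq_p_poly:
  "(-1) ^ n / fact n * (deriv ^^ n) (\<lambda>z. exp (- t * z powr \<alpha>)) 1 = exp (- t) * p_poly n \<alpha> t"
  using higher_deriv_exp_powr[of 1 "n - 1" t \<alpha>]
  by (cases n) (simp_all add: p_poly_def del: b_coeff.simps funpow.simps)

section \<open>Integrals along vertical lines\<close>

text \<open>
  The boundary of a tall rectangle between the two lines encloses the point \<open>p\<close>; its horizontal
  sides have fixed length, so they contribute nothing in the limit once the integrand decays. For an
  integrand without singularity at \<open>p\<close> this says that the line may be shifted.
\<close>

lemma vertical_line_integral_diff_residue:
  assumes \<sigma>: "0 < \<sigma>1" "\<sigma>1 < p" "p < \<sigma>2"
    and hol: "h holomorphic_on {z. Re z > 0} - {of_real p}"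
    and int: "integrable lborel (\<lambda>y. h (Complex \<sigma>1 y))" "integrable lborel (\<lambda>y. h (Complex \<sigma>2 y))"
    and decay: "(B \<longlongrightarrow> 0) at_top"
      "\<And>x y. \<sigma>1 \<le> x \<Longrightarrow> x \<le> \<sigma>2 \<Longrightarrow> 1 \<le> \<bar>y\<bar> \<Longrightarrow> norm (h (Complex x y)) \<le> B \<bar>y\<bar>"
  shows "vertical_line_integral \<sigma>2 h - vertical_line_integral \<sigma>1 h
       = 2 * of_real pi * \<i> * residue h (of_real p)"
proof -
  define S where "S = {z. Re z > 0}"
  define V where "V \<sigma> R = \<i> * integral {-R..R} (\<lambda>y. h (Complex \<sigma> y))" for \<sigma> R
  have VT: "(V \<sigma> \<longlongrightarrow> vertical_line_integral \<sigma> h) at_top"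
    if i: "integrable lborel (\<lambda>y. h (Complex \<sigma> y))" for \<sigma>
  proof -
    have "((\<lambda>R. LBINT y. indicator {-R..R} y *\<^sub>R h (Complex \<sigma> y)) \<longlongrightarrow> (LBINT y. h (Complex \<sigma> y))) at_top"
    proof (rule integral_dominated_convergence_at_top)
      show "integrable lborel (\<lambda>y. norm (h (Complex \<sigma> y)))" using i by simp
      show "AE y in lborel. ((\<lambda>R. indicator {-R..R} y *\<^sub>R h (Complex \<sigma> y)) \<longlongrightarrow> h (Complex \<sigma> y)) at_top"
      proof (intro AE_I2 tendsto_eventually)
        fix y :: real
        show "\<forall>\<^sub>F R in at_top. indicator {-R..R} y *\<^sub>R h (Complex \<sigma> y) = h (Complex \<sigma> y)"
          using eventually_ge_at_top[of "\<bar>y\<bar>"] by eventually_elim (auto simp: indicator_def)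
      qed
      show "\<forall>\<^sub>F R in at_top. AE y in lborel. norm (indicator {-R..R} y *\<^sub>R h (Complex \<sigma> y)) \<le> norm (h (Complex \<sigma> y))"
        by (intro always_eventually allI AE_I2) (auto simp: indicator_def)
    qed (use i in \<open>auto intro!: borel_measurable_scaleR\<close>)
    moreover have "(LBINT y. indicator {-R..R} y *\<^sub>R h (Complex \<sigma> y)) = integral {-R..R} (\<lambda>y. h (Complex \<sigma> y))" for R
      using set_borel_integral_eq_integral(2)[of "{-R..R}" "\<lambda>y. h (Complex \<sigma> y)"] i
      by (simp add: set_lebesgue_integral_def set_integrable_def integrable_mult_indicator)
    ultimately have "((\<lambda>R. \<i> * integral {-R..R} (\<lambda>y. h (Complex \<sigma> y))) \<longlongrightarrow> \<i> * (LBINT y. h (Complex \<sigma> y))) at_top"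
      by (intro tendsto_intros) simp
    then show ?thesis
      by (simp add: V_def[abs_def] vertical_line_integral_def mult.commute)
  qed
  let ?bd = "\<lambda>R. 2 * (B R * (\<sigma>2 - \<sigma>1))"
  have key: "norm ((V \<sigma>2 R - V \<sigma>1 R) - 2 * of_real pi * \<i> * residue h (of_real p)) \<le> ?bd R" if R: "R \<ge> 1" for R
  proof -
    define a1 a2 a3 a4 where "a1 = Complex \<sigma>1 (-R)" and "a2 = Complex \<sigma>2 (-R)"
      and "a3 = Complex \<sigma>2 R" and "a4 = Complex \<sigma>1 R"
    note a = a1_def a2_def a3_def a4_def
    let ?\<gamma> = "rectpath a1 a3"
    have img: "path_image ?\<gamma> \<subseteq> S - {of_real p}"
    proof -
      have "path_image ?\<gamma> \<subseteq> cbox a1 a3 - {of_real p}"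
        using \<sigma> R by (subst path_image_rectpath_cbox_minus_box) (auto simp: a in_box_complex_iff)
      moreover have "cbox a1 a3 \<subseteq> S" using \<sigma> by (auto simp: a S_def in_cbox_complex_iff)
      ultimately show ?thesis by blast
    qed
    have "contour_integral ?\<gamma> h = 2 * pi * \<i> * (\<Sum>q\<in>{of_real p}. winding_number ?\<gamma> q * residue h q)"
    proof (rule Residue_theorem)
      show "open S" unfolding S_def by (rule open_halfspace_Re_gt)
      show "connected S" unfolding S_def by (intro convex_connected convex_halfspace_Re_gt)
      show "h holomorphic_on S - {of_real p}" using hol by (simp add: S_def)
      show "\<forall>z. z \<notin> S \<longrightarrow> winding_number ?\<gamma> z = 0"
        using \<sigma> R by (intro allI impI winding_number_rectpath_outside) (auto simp: a S_def in_cbox_complex_iff)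
    qed (use img in \<open>auto\<close>)
    moreover have "winding_number ?\<gamma> (of_real p) = 1"
      using \<sigma> R by (intro winding_number_rectpath) (auto simp: a in_box_complex_iff)
    ultimately have total: "contour_integral ?\<gamma> h = 2 * of_real pi * \<i> * residue h (of_real p)"
      by simp
    have cont: "continuous_on (S - {of_real p}) h"
      using hol holomorphic_on_imp_continuous_on by (simp add: S_def)
    have segs: "closed_segment a1 a2 \<subseteq> S - {of_real p}" "closed_segment a2 a3 \<subseteq> S - {of_real p}"
       "closed_segment a3 a4 \<subseteq> S - {of_real p}" "closed_segment a4 a1 \<subseteq> S - {of_real p}"
      using img by (auto simp: rectpath_def Let_def path_image_join a)
    have ci: "h contour_integrable_on linepath a1 a2" "h contour_integrable_on linepath a2 a3"
       "h contour_integrable_on linepath a3 a4" "h contour_integrable_on linepath a4 a1"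
      by (intro contour_integrable_continuous_linepath continuous_on_subset[OF cont] segs)+
    have split: "contour_integral ?\<gamma> h = contour_integral (linepath a1 a2) h + contour_integral (linepath a2 a3) h
       + contour_integral (linepath a3 a4) h + contour_integral (linepath a4 a1) h"
      using ci by (simp add: rectpath_def Let_def a)
    have "contour_integral (linepath a2 a3) h = V \<sigma>2 R"
      unfolding V_def using R by (intro contour_integral_linepath_same_Re) (auto simp: a)
    moreover have "contour_integral (linepath a4 a1) h = - V \<sigma>1 R"
    proof -
      have "contour_integral (linepath a4 a1) h = - contour_integral (linepath a1 a4) h"
        using contour_integral_reverse_linepath[of a1 a4 h] continuous_on_subset[OF cont segs(4)]
        by (simp add: closed_segment_commute)
      also have "contour_integral (linepath a1 a4) h = V \<sigma>1 R"
        unfolding V_def using R by (intro contour_integral_linepath_same_Re) (auto simp: a)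
      finally show ?thesis .
    qed
    moreover have horiz: "norm (contour_integral (linepath u v) h) \<le> B R * (\<sigma>2 - \<sigma>1)"
      if ih: "h contour_integrable_on linepath u v"
        and uv: "{Re u, Re v} = {\<sigma>1, \<sigma>2}" "Im u = Im v" "\<bar>Im u\<bar> = R" for u v
    proof -
      have nB: "0 \<le> B R"
        using decay(2)[of \<sigma>1 R] \<sigma> R by (auto intro: order_trans[OF norm_ge_zero])
      have "norm (contour_integral (linepath u v) h) \<le> B R * norm (v - u)"
      proof (rule contour_integral_bound_linepath[OF ih nB])
        fix z assume "z \<in> closed_segment u v"
        then obtain s where s: "0 \<le> s" "s \<le> 1" "z = (1 - s) *\<^sub>R u + s *\<^sub>R v" by (auto simp: in_segment)
        have "Re z \<in> closed_segment (Re u) (Re v)" using s by (auto simp: in_segment)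
        also have "closed_segment (Re u) (Re v) = {\<sigma>1..\<sigma>2}"
          using uv(1) \<sigma> by (auto simp: doubleton_eq_iff closed_segment_eq_real_ivl)
        finally have re: "\<sigma>1 \<le> Re z" "Re z \<le> \<sigma>2" by auto
        have im: "Im z = Im u" unfolding s(3) by (simp add: uv(2)[symmetric] algebra_simps)
        have imR: "\<bar>Im z\<bar> = R" by (simp add: im uv(3))
        then have "1 \<le> \<bar>Im z\<bar>" using R by simp
        from decay(2)[OF re this] show "norm (h z) \<le> B R"
          by (simp only: complex.collapse imR)
      qed
      also have "norm (v - u) = \<sigma>2 - \<sigma>1"
        using uv \<sigma> by (auto simp: cmod_def doubleton_eq_iff)
      finally show ?thesis .
    qed
    moreover have "norm (contour_integral (linepath a1 a2) h) \<le> B R * (\<sigma>2 - \<sigma>1)"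
      using R by (intro horiz ci) (auto simp: a)
    moreover have "norm (contour_integral (linepath a3 a4) h) \<le> B R * (\<sigma>2 - \<sigma>1)"
      using R by (intro horiz ci) (auto simp: a)
    ultimately have "(V \<sigma>2 R - V \<sigma>1 R) - 2 * of_real pi * \<i> * residue h (of_real p)
        = - (contour_integral (linepath a1 a2) h + contour_integral (linepath a3 a4) h)"
      "norm (contour_integral (linepath a1 a2) h + contour_integral (linepath a3 a4) h) \<le> ?bd R"
      using split total norm_triangle_ineq[of "contour_integral (linepath a1 a2) h" "contour_integral (linepath a3 a4) h"]
      by (auto simp: algebra_simps)
    then show ?thesis by (simp only: norm_minus_cancel)
  qed
  have "((\<lambda>R. (V \<sigma>2 R - V \<sigma>1 R) - 2 * of_real pi * \<i> * residue h (of_real p)) \<longlongrightarrow> 0) at_top"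
  proof (rule Lim_null_comparison)
    show "\<forall>\<^sub>F R in at_top. norm ((V \<sigma>2 R - V \<sigma>1 R) - 2 * of_real pi * \<i> * residue h (of_real p)) \<le> ?bd R"
      using eventually_ge_at_top[of 1] by eventually_elim (rule key)
    show "(?bd \<longlongrightarrow> 0) at_top"
      using tendsto_mult[OF tendsto_const tendsto_mult[OF decay(1) tendsto_const], of 2 "\<sigma>2 - \<sigma>1"] by simp
  qed
  moreover have "((\<lambda>R. (V \<sigma>2 R - V \<sigma>1 R) - 2 * of_real pi * \<i> * residue h (of_real p)) \<longlongrightarrow>
     (vertical_line_integral \<sigma>2 h - vertical_line_integral \<sigma>1 h) - 2 * of_real pi * \<i> * residue h (of_real p)) at_top"
    by (intro tendsto_intros VT int)
  ultimately show ?thesis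
    using tendsto_unique[OF trivial_limit_at_top_linorder] by fastforce
qed

section \<open>Integrals over the positive half-line\<close>

lemma set_integral_FTC_Ioi:
  fixes F f :: "real \<Rightarrow> complex"
  assumes "\<And>x. x > 0 \<Longrightarrow> (F has_vector_derivative f x) (at x)"
    and "\<And>x. x > 0 \<Longrightarrow> isCont f x"
    and "set_integrable lborel {0<..} f"
    and "(F \<longlongrightarrow> A) (at_right 0)" and "(F \<longlongrightarrow> B) at_top"
  shows "(LBINT x:{0<..}. f x) = B - A"
proof -
  have "(LBINT x=0..\<infinity>. f x) = B - A"
  proof (rule interval_integral_FTC_integrable)
    show "((F \<circ> real_of_ereal) \<longlongrightarrow> A) (at_right 0)"
      using assms(4) by (simp add: zero_ereal_def ereal_tendsto_simps)
    show "((F \<circ> real_of_ereal) \<longlongrightarrow> B) (at_left \<infinity>)"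
      using assms(5) by (simp add: ereal_tendsto_simps)
  qed (use assms in \<open>simp_all add: zero_ereal_def\<close>)
  then show ?thesis
    by (simp add: interval_lebesgue_integral_0_infty)
qed

lemma set_integrable_powr_exp:
  assumes "a > -1" "u > 0"
  shows "set_integrable lborel {0<..} (\<lambda>r. r powr a * exp (- (u * r)) :: real)"
proof -
  have "(\<lambda>t. complex_of_real t powr (of_real (a + 1) - 1) / of_real (exp (u * t))) absolutely_integrable_on {0<..}"
    using assms by (intro absolutely_integrable_Gamma_integral) auto
  then have "set_integrable lborel {0<..} (\<lambda>t. complex_of_real t powr (of_real (a + 1) - 1) / of_real (exp (u * t)))"
    unfolding set_integrable_def by (subst (asm) integrable_completion) (auto intro!: measurable_If)
  then have "set_integrable lborel {0<..} (\<lambda>t. norm (complex_of_real t powr (of_real (a + 1) - 1) / of_real (exp (u * t))))"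
    by (rule set_integrable_norm)
  then show ?thesis
    by (rule set_integrable_cong[THEN iffD1, rotated 3])
       (auto simp: norm_divide norm_powr_real_powr exp_minus field_simps)
qed

lemma set_integrable_power_exp:
  fixes w :: complex
  assumes "Re w > 0"
  shows "set_integrable lborel {0<..} (\<lambda>r. of_real (r ^ n / fact n) * exp (- w * of_real r))"
proof (rule set_integrable_bound)
  show "set_integrable lborel {0<..} (\<lambda>r. 1 / fact n * (r powr real n * exp (- (Re w * r))) :: real)"
    using assms by (intro set_integrable_mult_right set_integrable_powr_exp) auto
  show "AE r in lborel. r \<in> {0<..} \<longrightarrow> norm (of_real (r ^ n / fact n) * exp (- w * of_real r))
          \<le> norm (1 / fact n * (r powr real n * exp (- (Re w * r))))"
    by (intro AE_I2) (auto simp: norm_mult norm_divide norm_power powr_realpow)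
  show "set_borel_measurable lborel {0<..} (\<lambda>r. of_real (r ^ n / fact n) * exp (- w * of_real r))"
    unfolding set_borel_measurable_def by measurable
qed

text \<open>
  Each power reduces to the previous one by integration by parts, in the form that the derivative
  of a function vanishing at both ends has integral \<open>0\<close>.
\<close>

lemma laplace_transform_power:
  fixes w :: complex
  assumes w: "Re w > 0"
  shows "(LBINT r:{0<..}. of_real (r ^ n / fact n) * exp (- w * of_real r)) = 1 / w ^ Suc n"
proof (induction n)
  case 0
  have "(LBINT r:{0<..}. exp (- w * of_real r)) = 0 - (- 1 / w)"
  proof (rule set_integral_FTC_Ioi)
    fix r :: real
    have "((\<lambda>z. - exp (- w * z) / w) has_field_derivative exp (- w * of_real r)) (at (of_real r))"
      using w by (auto intro!: derivative_eq_intros)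
    then show "((\<lambda>r. - exp (- w * of_real r) / w) has_vector_derivative exp (- w * of_real r)) (at r)"
      by (rule has_vector_derivative_real_field)
    show "isCont (\<lambda>r. exp (- w * of_real r)) r" by (intro continuous_intros)
  next
    show "set_integrable lborel {0<..} (\<lambda>r. exp (- w * of_real r))"
      using set_integrable_power_exp[OF w, of 0] by simp
    show "((\<lambda>r. - exp (- w * complex_of_real r) / w) \<longlongrightarrow> - 1 / w) (at_right 0)"
      by (rule tendsto_eq_intros refl | use w in force)+
    have "((\<lambda>r. exp (- Re w * r)) \<longlongrightarrow> 0) at_top"
      using w by real_asymp
    then have "((\<lambda>r. exp (- Re w * r) / norm w) \<longlongrightarrow> 0) at_top"
      by (rule tendsto_divide_zero)
    then show "((\<lambda>r. - exp (- w * complex_of_real r) / w) \<longlongrightarrow> 0) at_top"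
      by (rule Lim_null_comparison[rotated]) (simp add: norm_divide)
  qed
  then show ?case by simp
next
  case (Suc n)
  let ?f = "\<lambda>n r. of_real (r ^ n / fact n) * exp (- w * of_real r)"
  note i = set_integrable_power_exp[OF w]
  have nz: "1 + complex_of_nat n \<noteq> 0" by (metis of_nat_Suc of_nat_neq_0)
  have "(LBINT r:{0<..}. ?f n r - w * ?f (Suc n) r) = 0 - 0"
  proof (rule set_integral_FTC_Ioi)
    fix r :: real
    have "((\<lambda>z. z ^ Suc n / fact (Suc n) * exp (- w * z)) has_field_derivative ?f n r - w * ?f (Suc n) r) (at (of_real r))"
      by (auto intro!: derivative_eq_intros simp del: fact_Suc power_Suc) (simp add: fact_Suc divide_simps nz)
    then have "((\<lambda>r. of_real r ^ Suc n / fact (Suc n) * exp (- w * of_real r)) has_vector_derivative ?f n r - w * ?f (Suc n) r) (at r)"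
      by (rule has_vector_derivative_real_field)
    then show "(?f (Suc n) has_vector_derivative ?f n r - w * ?f (Suc n) r) (at r)"
      by (simp del: fact_Suc power_Suc)
    show "isCont (\<lambda>r. ?f n r - w * ?f (Suc n) r) r" by (intro continuous_intros) simp_all
  next
    show "set_integrable lborel {0<..} (\<lambda>r. ?f n r - w * ?f (Suc n) r)"
      by (intro set_integral_diff set_integrable_mult_right i)
    show "(?f (Suc n) \<longlongrightarrow> 0) (at_right 0)"
      by (rule tendsto_eq_intros refl | force)+
    have "((\<lambda>r. r ^ Suc n / fact (Suc n) * exp (- Re w * r)) \<longlongrightarrow> 0) at_top"
      using w by real_asymp
    then show "(?f (Suc n) \<longlongrightarrow> 0) at_top"
      by (rule Lim_null_comparison[rotated])
         (auto intro!: eventually_mono[OF eventually_gt_at_top[of 0]] simp: norm_mult norm_divide norm_power simp del: power_Suc fact_Suc)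
  qed
  then have "(LBINT r:{0<..}. ?f n r) - w * (LBINT r:{0<..}. ?f (Suc n) r) = 0"
    using i by (simp add: set_integral_diff set_integrable_mult_right del: fact_Suc power_Suc)
  then have *: "w * (LBINT r:{0<..}. ?f (Suc n) r) = 1 / w ^ Suc n"
    unfolding Suc.IH by (metis diff_eq_diff_eq diff_self eq_iff_diff_eq_0)
  have "w \<noteq> 0" using w by auto
  then have "(LBINT r:{0<..}. ?f (Suc n) r) = w * (LBINT r:{0<..}. ?f (Suc n) r) / w"
    by simp
  also have "\<dots> = 1 / w ^ Suc (Suc n)"
    unfolding * by simp
  finally show ?case .
qed

text \<open>
  The majorant \<open>r ^ n / n! * exp (- r / 2)\<close> of the moment integrands, with its exact mass: the
  factor \<open>exp (- r)\<close> of the moments is weakened by the growth \<open>exp (r / 2)\<close> allowed to the density.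
\<close>

lemma laplace_power_half:
  "has_bochner_integral lborel (\<lambda>r. indicator {0<..} r * (r ^ n / fact n * exp (- (r / 2)))) (2 ^ Suc n :: real)"
proof -
  have *: "indicator {0<..} r *\<^sub>R (of_real (r ^ n / fact n) * exp (- (1/2) * of_real r))
      = complex_of_real (indicator {0<..} r * (r ^ n / fact n * exp (- (r / 2))))" for r
    by (simp add: indicator_def exp_of_real[symmetric])
  have "has_bochner_integral lborel (\<lambda>r. complex_of_real (indicator {0<..} r * (r ^ n / fact n * exp (- (r / 2))))) (1 / (1/2) ^ Suc n)"
    using set_integrable_power_exp[of "1/2" n] laplace_transform_power[of "1/2" n]
    unfolding has_bochner_integral_iff set_integrable_def set_lebesgue_integral_def * by simp
  then have "has_bochner_integral lborel (\<lambda>r. complex_of_real (indicator {0<..} r * (r ^ n / fact n * exp (- (r / 2))))) (of_real (2 ^ Suc n))"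
    by (simp add: field_simps)
  then show ?thesis
    unfolding has_bochner_integral_iff complex_of_real_integrable_eq integral_complex_of_real of_real_eq_iff .
qed

section \<open>Moments of the stable density\<close>

text \<open>
  The argument of \<open>z\<close> is below \<open>\<pi> / 2\<close> in modulus, so the argument of \<open>z powr \<alpha>\<close> is at most
  \<open>\<pi> \<alpha> / 2 < \<pi> / 2\<close>.
\<close>

lemma Re_powr_lower_bound:
  fixes \<alpha> :: real
  assumes \<alpha>: "0 < \<alpha>" "\<alpha> < 1" and z: "Re z > 0"
  shows "cos (pi * \<alpha> / 2) * norm z powr \<alpha> \<le> Re (z powr of_real \<alpha>)"
proof -
  have nz: "z \<noteq> 0" using z by auto
  define \<theta> where "\<theta> = \<alpha> * Im (Ln z)"
  have "\<bar>Im (Ln z)\<bar> < pi / 2" using z Re_Ln_pos_lt nz by blast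
  then have "\<alpha> * \<bar>Im (Ln z)\<bar> \<le> \<alpha> * (pi / 2)" using \<alpha> by (intro mult_left_mono) auto
  then have "\<bar>\<theta>\<bar> \<le> pi * \<alpha> / 2" using \<alpha> by (simp add: \<theta>_def abs_mult mult.commute)
  moreover have "pi * \<alpha> / 2 \<le> pi"
    using \<alpha> by (simp add: field_simps)
  ultimately have "cos (pi * \<alpha> / 2) \<le> cos \<bar>\<theta>\<bar>"
    by (intro cos_monotone_0_pi_le) auto
  then have "cos (pi * \<alpha> / 2) \<le> cos \<theta>" by simp
  moreover have "Re (z powr of_real \<alpha>) = cos \<theta> * norm z powr \<alpha>"
    using nz by (simp add: powr_def Re_exp \<theta>_def mult.commute)
  ultimately show ?thesis by (simp add: mult_right_mono)
qed

text \<open>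
  The Laplace transform that the density is going to have.
\<close>

definition levy_exp :: "real \<Rightarrow> real \<Rightarrow> complex \<Rightarrow> complex" where
  "levy_exp t \<alpha> z = exp (- of_real t * z powr of_real \<alpha>)"

lemma levy_exp_holomorphic: "levy_exp t \<alpha> holomorphic_on {z. Re z > 0}"
  unfolding levy_exp_def by (auto intro!: holomorphic_intros simp: complex_nonpos_Reals_iff)

lemma levy_exp_line_measurable:
  assumes "\<sigma> > 0"
  shows "(\<lambda>y. levy_exp t \<alpha> (Complex \<sigma> y)) \<in> borel_measurable borel"
proof (rule borel_measurable_continuous_onI)
  have "continuous_on UNIV (levy_exp t \<alpha> \<circ> Complex \<sigma>)"
  proof (rule continuous_on_compose)
    show "continuous_on UNIV (Complex \<sigma>)"
      unfolding Complex_eq by (intro continuous_intros)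
    show "continuous_on (range (Complex \<sigma>)) (levy_exp t \<alpha>)"
      using assms by (intro continuous_on_subset[OF holomorphic_on_imp_continuous_on[OF levy_exp_holomorphic]]) auto
  qed
  then show "continuous_on UNIV (\<lambda>y. levy_exp t \<alpha> (Complex \<sigma> y))" by (simp add: o_def)
qed

lemma stable_levy_eq:
  "stable_levy \<sigma> t \<alpha> r =
     1 / (2 * of_real pi * \<i>) * vertical_line_integral \<sigma> (\<lambda>z. exp (z * of_real r) * levy_exp t \<alpha> z)"
  by (simp add: stable_levy_def levy_exp_def exp_add[symmetric])

text \<open>
  A stretched exponential is eventually below \<open>1 / (1 + y\<^sup>2)\<close>.
\<close>

lemma integrable_exp_minus_powr:
  fixes c \<alpha> :: real
  assumes "c > 0" "\<alpha> > 0"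
  shows "integrable lborel (\<lambda>y. exp (- c * \<bar>y\<bar> powr \<alpha>))"
proof -
  have "((\<lambda>y. (1 + y\<^sup>2) * exp (- c * y powr \<alpha>)) \<longlongrightarrow> 0) at_top"
    using assms by real_asymp
  then have "\<forall>\<^sub>F y in at_top. (1 + y\<^sup>2) * exp (- c * y powr \<alpha>) < 1"
    by (rule order_tendstoD) simp
  then obtain Y where Y: "\<And>y. y \<ge> Y \<Longrightarrow> (1 + y\<^sup>2) * exp (- c * y powr \<alpha>) < 1"
    by (auto simp: eventually_at_top_linorder)
  have "integrable lborel (\<lambda>y. (1 + Y\<^sup>2) * inverse (1 + y\<^sup>2))"
    using integrable_inverse_1_plus_square by (simp add: set_integrable_def)
  then show ?thesis
  proof (rule Bochner_Integration.integrable_bound)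
    \<comment> \<open>the constant \<open>1 + Y\<^sup>2\<close> is chosen to cover the range below \<open>Y\<close>, where the exponential is at most \<open>1\<close>\<close>
    have "exp (- c * \<bar>y\<bar> powr \<alpha>) \<le> (1 + Y\<^sup>2) * inverse (1 + y\<^sup>2)" for y
    proof (cases "\<bar>y\<bar> \<ge> Y")
      case True
      have "(1 + y\<^sup>2) * exp (- c * \<bar>y\<bar> powr \<alpha>) \<le> 1" using Y[OF True] by simp
      moreover have "0 < 1 + y\<^sup>2" by (simp add: add_pos_nonneg)
      ultimately have "exp (- c * \<bar>y\<bar> powr \<alpha>) \<le> inverse (1 + y\<^sup>2)" by (simp add: field_simps)
      also have "\<dots> = 1 * inverse (1 + y\<^sup>2)" by simp
      also have "\<dots> \<le> (1 + Y\<^sup>2) * inverse (1 + y\<^sup>2)" by (intro mult_right_mono) auto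
      finally show ?thesis .
    next
      case False
      have "y\<^sup>2 \<le> Y\<^sup>2" using False power_mono[of "\<bar>y\<bar>" Y 2] by simp
      moreover have "0 < 1 + y\<^sup>2" by (simp add: add_pos_nonneg)
      ultimately have "1 \<le> (1 + Y\<^sup>2) * inverse (1 + y\<^sup>2)" by (simp add: field_simps)
      moreover have "exp (- c * \<bar>y\<bar> powr \<alpha>) \<le> 1" using assms by simp
      ultimately show ?thesis by linarith
    qed
    then show "AE y in lborel. norm (exp (- c * \<bar>y\<bar> powr \<alpha>)) \<le> norm ((1 + Y\<^sup>2) * inverse (1 + y\<^sup>2))"
      by (intro AE_I2) (auto intro: order_trans[OF _ abs_ge_self])
  qed measurable
qed

context
  fixes t \<alpha> :: real
  assumes \<alpha>: "0 < \<alpha>" "\<alpha> < 1" and t: "0 < t"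
begin

definition decay_rate :: real where
  "decay_rate = t * cos (pi * \<alpha> / 2)"

lemma decay_rate_pos: "decay_rate > 0"
proof -
  have "- (pi / 2) < pi * \<alpha> / 2"
    by (rule less_trans[of _ 0]) (use \<alpha> in auto)
  then have "0 < cos (pi * \<alpha> / 2)"
    using \<alpha> by (intro cos_gt_zero_pi) auto
  then show ?thesis using t by (simp add: decay_rate_def)
qed

lemma norm_levy_exp_le:
  assumes "x > 0"
  shows "norm (levy_exp t \<alpha> (Complex x y)) \<le> exp (- decay_rate * \<bar>y\<bar> powr \<alpha>)"
proof -
  let ?z = "Complex x y"
  have "0 < cos (pi * \<alpha> / 2)"
    using decay_rate_pos t by (simp add: decay_rate_def zero_less_mult_iff)
  moreover have "\<bar>y\<bar> powr \<alpha> \<le> norm ?z powr \<alpha>"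
    using \<alpha> abs_Im_le_cmod[of ?z] by (intro powr_mono2) auto
  ultimately have "cos (pi * \<alpha> / 2) * \<bar>y\<bar> powr \<alpha> \<le> cos (pi * \<alpha> / 2) * norm ?z powr \<alpha>"
    by (intro mult_left_mono) auto
  also have "\<dots> \<le> Re (?z powr of_real \<alpha>)"
    using \<alpha> assms by (intro Re_powr_lower_bound) auto
  finally have "t * (cos (pi * \<alpha> / 2) * \<bar>y\<bar> powr \<alpha>) \<le> t * Re (?z powr of_real \<alpha>)"
    using t by (intro mult_left_mono) auto
  then show ?thesis
    by (simp add: levy_exp_def decay_rate_def mult.assoc)
qed

lemma integrable_decay: "integrable lborel (\<lambda>y. exp (- decay_rate * \<bar>y\<bar> powr \<alpha>))"
  by (rule integrable_exp_minus_powr[OF decay_rate_pos \<alpha>(1)])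

lemma decay_tendsto_0: "((\<lambda>y. exp (- decay_rate * y powr \<alpha>)) \<longlongrightarrow> 0) at_top"
  using decay_rate_pos \<alpha>(1) by real_asymp

lemma integrable_levy_exp_line:
  assumes "\<sigma> > 0" and [measurable]: "u \<in> borel_measurable borel" and "\<And>y. norm (u y) \<le> M"
  shows "integrable lborel (\<lambda>y. u y * levy_exp t \<alpha> (Complex \<sigma> y))"
proof (rule Bochner_Integration.integrable_bound)
  note [measurable] = levy_exp_line_measurable[OF assms(1)]
  show "integrable lborel (\<lambda>y. M * exp (- decay_rate * \<bar>y\<bar> powr \<alpha>))"
    using integrable_decay by simp
  show "(\<lambda>y. u y * levy_exp t \<alpha> (Complex \<sigma> y)) \<in> borel_measurable lborel" by measurable
  have "M \<ge> 0" by (rule order_trans[OF norm_ge_zero assms(3)])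
  then show "AE y in lborel. norm (u y * levy_exp t \<alpha> (Complex \<sigma> y)) \<le> norm (M * exp (- decay_rate * \<bar>y\<bar> powr \<alpha>))"
    using assms norm_levy_exp_le[OF assms(1)] by (intro AE_I2) (auto simp: norm_mult intro!: mult_mono)
qed

text \<open>
  The exponential decays so fast along vertical lines that any bounded factor \<open>u\<close> is admissible.
\<close>

lemma levy_exp_line_diff_residue:
  assumes \<sigma>: "0 < \<sigma>1" "\<sigma>1 < p" "p < \<sigma>2"
    and u: "u holomorphic_on {z. Re z > 0} - {of_real p}"
    and ul: "\<And>\<sigma>. \<sigma> \<in> {\<sigma>1, \<sigma>2} \<Longrightarrow> (\<lambda>y. u (Complex \<sigma> y)) \<in> borel_measurable borel"
    and M: "\<And>\<sigma> y. \<sigma> \<in> {\<sigma>1, \<sigma>2} \<Longrightarrow> norm (u (Complex \<sigma> y)) \<le> M"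
    and M': "\<And>x y. \<sigma>1 \<le> x \<Longrightarrow> x \<le> \<sigma>2 \<Longrightarrow> 1 \<le> \<bar>y\<bar> \<Longrightarrow> norm (u (Complex x y)) \<le> M"
  shows "vertical_line_integral \<sigma>2 (\<lambda>z. u z * levy_exp t \<alpha> z) - vertical_line_integral \<sigma>1 (\<lambda>z. u z * levy_exp t \<alpha> z)
       = 2 * of_real pi * \<i> * residue (\<lambda>z. u z * levy_exp t \<alpha> z) (of_real p)"
proof (rule vertical_line_integral_diff_residue[OF \<sigma>, where B = "\<lambda>y. M * exp (- decay_rate * y powr \<alpha>)"])
  show "(\<lambda>z. u z * levy_exp t \<alpha> z) holomorphic_on {z. 0 < Re z} - {complex_of_real p}"
    by (intro holomorphic_intros u holomorphic_on_subset[OF levy_exp_holomorphic]) auto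
  show "integrable lborel (\<lambda>y. u (Complex \<sigma>1 y) * levy_exp t \<alpha> (Complex \<sigma>1 y))"
    "integrable lborel (\<lambda>y. u (Complex \<sigma>2 y) * levy_exp t \<alpha> (Complex \<sigma>2 y))"
    using \<sigma> by (auto intro!: integrable_levy_exp_line[of _ _ M] ul M)
  show "((\<lambda>y. M * exp (- decay_rate * y powr \<alpha>)) \<longlongrightarrow> 0) at_top"
    by (rule tendsto_mult_right_zero[OF decay_tendsto_0])
  have "M \<ge> 0" using order_trans[OF norm_ge_zero M[of \<sigma>1 0]] by simp
  then show "norm (u (Complex x y) * levy_exp t \<alpha> (Complex x y)) \<le> M * exp (- decay_rate * \<bar>y\<bar> powr \<alpha>)"
    if "\<sigma>1 \<le> x" "x \<le> \<sigma>2" "1 \<le> \<bar>y\<bar>" for x y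
    using M'[OF that] norm_levy_exp_le[of x y] \<sigma> that by (auto simp: norm_mult intro!: mult_mono)
qed

text \<open>
  The integrand is holomorphic in the right half-plane, so the residue picked up in passing from
  one line to the other is zero; the point \<open>p\<close> between the lines is arbitrary.
\<close>

lemma stable_levy_abscissa_less:
  assumes "0 < \<sigma>1" "\<sigma>1 < \<sigma>2"
  shows "stable_levy \<sigma>2 t \<alpha> r = stable_levy \<sigma>1 t \<alpha> r"
proof -
  define p where "p = (\<sigma>1 + \<sigma>2) / 2"
  have p: "\<sigma>1 < p" "p < \<sigma>2" using assms by (auto simp: p_def)
  let ?u = "\<lambda>z. exp (z * complex_of_real r)"
  have bound: "norm (?u (Complex x y)) \<le> exp (\<sigma>2 * \<bar>r\<bar>)" if "0 < x" "x \<le> \<sigma>2" for x y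
  proof -
    have "x * r \<le> x * \<bar>r\<bar>" using that by (intro mult_left_mono) auto
    also have "\<dots> \<le> \<sigma>2 * \<bar>r\<bar>" using that by (intro mult_right_mono) auto
    finally show ?thesis by simp
  qed
  have "vertical_line_integral \<sigma>2 (\<lambda>z. ?u z * levy_exp t \<alpha> z) - vertical_line_integral \<sigma>1 (\<lambda>z. ?u z * levy_exp t \<alpha> z)
       = 2 * of_real pi * \<i> * residue (\<lambda>z. ?u z * levy_exp t \<alpha> z) (of_real p)"
  proof (rule levy_exp_line_diff_residue[OF assms(1) p, where M = "exp (\<sigma>2 * \<bar>r\<bar>)"])
    show "(\<lambda>y. ?u (Complex \<sigma> y)) \<in> borel_measurable borel" for \<sigma>
      unfolding Complex_eq by measurable
    show "norm (?u (Complex \<sigma> y)) \<le> exp (\<sigma>2 * \<bar>r\<bar>)" if "\<sigma> \<in> {\<sigma>1, \<sigma>2}" for \<sigma> y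
      using that assms by (intro bound) auto
    show "norm (?u (Complex x y)) \<le> exp (\<sigma>2 * \<bar>r\<bar>)" if "\<sigma>1 \<le> x" "x \<le> \<sigma>2" for x y
      using that assms by (intro bound) auto
  qed (intro holomorphic_intros)
  also have "residue (\<lambda>z. ?u z * levy_exp t \<alpha> z) (of_real p) = 0"
    using assms p by (intro residue_holo[of "{z. Re z > 0}"] holomorphic_intros levy_exp_holomorphic open_halfspace_Re_gt) auto
  finally show ?thesis
    by (simp add: stable_levy_eq)
qed

lemma stable_levy_abscissa_indep:
  assumes "0 < \<sigma>1" "0 < \<sigma>2"
  shows "stable_levy \<sigma>1 t \<alpha> r = stable_levy \<sigma>2 t \<alpha> r"
  using stable_levy_abscissa_less assms by (metis linorder_neqE_linordered_idom)

text \<open>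
  Move the line of integration to the right. Crossing \<open>z = 1\<close> picks up the residue of a pole of
  order \<open>n + 1\<close>, that is an \<open>n\<close>-th derivative of the exponential at \<open>1\<close>, and beyond the pole the
  integral tends to \<open>0\<close> because the rational factor does, uniformly on the line.
\<close>

lemma vertical_integral_levy_exp_over_power:
  "vertical_line_integral (1/2) (\<lambda>z. 1 / (1 - z) ^ Suc n * levy_exp t \<alpha> z)
     = 2 * of_real pi * \<i> * (exp (- of_real t) * p_poly n (of_real \<alpha>) (of_real t))"
proof -
  define u where "u z = 1 / (1 - z) ^ Suc n" for z :: complex
  let ?h = "\<lambda>z. u z * levy_exp t \<alpha> z"
  define I where "I = vertical_line_integral (1/2) ?h"
  define D where "D = 2 * of_real pi * \<i> * residue ?h 1"
  have u_bound: "norm (u z) \<le> 1 / d ^ Suc n" if "d > 0" "d \<le> norm (1 - z)" for z d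
    unfolding u_def using that by (simp add: norm_divide norm_power frac_le power_mono zero_less_mult_iff del: power_Suc)
  have u_meas [measurable]: "(\<lambda>y. u (Complex \<sigma> y)) \<in> borel_measurable borel" for \<sigma>
    unfolding u_def Complex_eq by measurable
  have diff: "vertical_line_integral \<sigma> ?h - I = D" if "\<sigma> \<ge> 3/2" for \<sigma>
  proof -
    have far: "1/2 \<le> norm (1 - Complex x y)" if "x \<le> 1/2 \<or> 3/2 \<le> x \<or> 1 \<le> \<bar>y\<bar>" for x y
      using that abs_Re_le_cmod[of "1 - Complex x y"] abs_Im_le_cmod[of "1 - Complex x y"]
      by auto
    have "vertical_line_integral \<sigma> ?h - vertical_line_integral (1/2) ?h = 2 * of_real pi * \<i> * residue ?h (of_real 1)"
    proof (rule levy_exp_line_diff_residue[where M = "1 / (1/2) ^ Suc n"])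
      show "u holomorphic_on {z. 0 < Re z} - {of_real 1}"
        unfolding u_def by (auto intro!: holomorphic_intros)
      show "norm (u (Complex \<sigma>' y)) \<le> 1 / (1/2) ^ Suc n" if "\<sigma>' \<in> {1/2, \<sigma>}" for \<sigma>' y
        using that \<open>\<sigma> \<ge> 3/2\<close> by (intro u_bound far) auto
      show "norm (u (Complex x y)) \<le> 1 / (1/2) ^ Suc n" if "1 \<le> \<bar>y\<bar>" for x y
        using that by (intro u_bound far) auto
    qed (use that in auto)
    then show ?thesis by (simp add: I_def D_def)
  qed
  define K where "K = (LBINT y. exp (- decay_rate * \<bar>y\<bar> powr \<alpha>))"
  \<comment> \<open>\<open>I + D\<close> is the integral over each line beyond the pole, hence arbitrarily small\<close>
  have "norm (I + D) \<le> 1 / (\<sigma> - 1) ^ Suc n * K" if "\<sigma> \<ge> 3/2" for \<sigma>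
  proof -
    have nn: "0 \<le> 1 / (\<sigma> - 1) ^ Suc n" using that by simp
    have "norm (vertical_line_integral \<sigma> ?h) \<le> (LBINT y. 1 / (\<sigma> - 1) ^ Suc n * exp (- decay_rate * \<bar>y\<bar> powr \<alpha>))"
      unfolding vertical_line_integral_def
    proof (rule Bochner_Integration.integral_norm_bound_integral)
      fix y :: real
      have "norm (u (Complex \<sigma> y)) \<le> 1 / (\<sigma> - 1) ^ Suc n"
        using that abs_Re_le_cmod[of "1 - Complex \<sigma> y"] by (intro u_bound) auto
      then have "norm (u (Complex \<sigma> y)) * norm (levy_exp t \<alpha> (Complex \<sigma> y)) \<le> 1 / (\<sigma> - 1) ^ Suc n * exp (- decay_rate * \<bar>y\<bar> powr \<alpha>)"
        using that nn by (intro mult_mono norm_levy_exp_le) auto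
      then show "norm (u (Complex \<sigma> y) * levy_exp t \<alpha> (Complex \<sigma> y) * \<i>) \<le> 1 / (\<sigma> - 1) ^ Suc n * exp (- decay_rate * \<bar>y\<bar> powr \<alpha>)"
        by (simp add: norm_mult)
    next
      have "norm (u (Complex \<sigma> y)) \<le> 1 / (\<sigma> - 1) ^ Suc n" for y
        using that abs_Re_le_cmod[of "1 - Complex \<sigma> y"] by (intro u_bound) auto
      then show "integrable lborel (\<lambda>y. u (Complex \<sigma> y) * levy_exp t \<alpha> (Complex \<sigma> y) * \<i>)"
        using that by (intro integrable_mult_left integrable_levy_exp_line) auto
    qed (use integrable_decay in simp)
    also have "\<dots> = 1 / (\<sigma> - 1) ^ Suc n * K"
      unfolding K_def by (rule integral_mult_right_zero)
    finally show ?thesis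
      using diff[OF that] by (simp add: diff_eq_eq add.commute)
  qed
  then have "\<forall>\<^sub>F \<sigma> in at_top. norm (I + D) \<le> 1 / (\<sigma> - 1) ^ Suc n * K"
    by (intro eventually_at_top_linorderI[of "3/2"]) auto
  moreover have "((\<lambda>\<sigma>::real. 1 / (\<sigma> - 1) ^ Suc n * K) \<longlongrightarrow> 0) at_top"
  proof (rule tendsto_mult_left_zero, rule tendsto_divide_0[OF tendsto_const])
    have "filterlim (\<lambda>\<sigma>::real. \<sigma> - 1) at_top at_top" by real_asymp
    then have "filterlim (\<lambda>\<sigma>::real. (\<sigma> - 1) ^ Suc n) at_top at_top"
      by (intro filterlim_pow_at_top) auto
    then show "filterlim (\<lambda>\<sigma>::real. (\<sigma> - 1) ^ Suc n) at_infinity at_top"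
      by (rule filterlim_at_top_imp_at_infinity)
  qed
  ultimately have "norm (I + D) \<le> 0"
    by (intro tendsto_lowerbound[where F = at_top]) auto
  then have I: "I = - D" by (simp add: add_eq_0_iff)
  have "residue ?h 1 = - (exp (- of_real t) * p_poly n (of_real \<alpha>) (of_real t))"
  proof -
    have "?h = (\<lambda>z. (-1) ^ Suc n * (levy_exp t \<alpha> z / (z - 1) ^ Suc n))"
      by (rule ext) (use power_minus[of "z - 1" "Suc n" for z :: complex] in \<open>simp add: u_def divide_simps del: power_Suc\<close>)
    then have "residue ?h 1 = (-1) ^ Suc n * residue (\<lambda>z. levy_exp t \<alpha> z / (z - 1) ^ Suc n) 1"
      by (simp only:) (rule residue_lmul[of "{z. Re z > 0}"]; auto intro!: open_halfspace_Re_gt holomorphic_intros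
           holomorphic_on_subset[OF levy_exp_holomorphic])
    also have "residue (\<lambda>z. levy_exp t \<alpha> z / (z - 1) ^ Suc n) 1 = (deriv ^^ n) (levy_exp t \<alpha>) 1 / fact n"
      by (rule residue_holomorphic_over_power[OF open_halfspace_Re_gt[of 0] _ levy_exp_holomorphic]) simp
    also have "(-1) ^ Suc n * ((deriv ^^ n) (levy_exp t \<alpha>) 1 / fact n)
        = - ((-1) ^ n / fact n * (deriv ^^ n) (\<lambda>z. exp (- of_real t * z powr of_real \<alpha>)) 1)"
      by (simp add: levy_exp_def[abs_def])
    finally show ?thesis
      by (simp only: higher_deriv_eq_p_poly)
  qed
  then show ?thesis
    using I by (simp add: I_def D_def u_def[abs_def])
qed

lemma stable_levy_measurable [measurable]: "stable_levy (1/2) t \<alpha> \<in> borel_measurable borel"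
proof -
  note [measurable] = levy_exp_line_measurable[of "1/2"]
  have "(\<lambda>r. 1 / (2 * of_real pi * \<i>) * (LBINT y. exp ((of_real (1/2) + \<i> * of_real y) * of_real r) * levy_exp t \<alpha> (Complex (1/2) y) * \<i>))
      \<in> borel_measurable borel"
    by measurable
  then show ?thesis
    by (subst ext[OF stable_levy_eq]) (simp add: vertical_line_integral_def Complex_eq)
qed

definition levy_mass :: real where
  "levy_mass = 1 / (2 * pi) * (LBINT y. exp (- decay_rate * \<bar>y\<bar> powr \<alpha>))"

text \<open>
  Taking absolute values on the line \<open>Re z = 1/2\<close> leaves the growth \<open>exp (r / 2)\<close>. Any abscissa
  strictly between \<open>0\<close> and \<open>1\<close> would serve: the weight \<open>exp (- r)\<close> has to win.
\<close>

lemma norm_stable_levy_le: "norm (stable_levy (1/2) t \<alpha> r) \<le> levy_mass * exp (r / 2)"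
proof -
  have "norm (vertical_line_integral (1/2) (\<lambda>z. exp (z * of_real r) * levy_exp t \<alpha> z))
      \<le> (LBINT y. exp (r / 2) * exp (- decay_rate * \<bar>y\<bar> powr \<alpha>))"
    unfolding vertical_line_integral_def
  proof (rule Bochner_Integration.integral_norm_bound_integral)
    show "integrable lborel (\<lambda>y. exp (Complex (1 / 2) y * of_real r) * levy_exp t \<alpha> (Complex (1 / 2) y) * \<i>)"
    proof (intro integrable_mult_left integrable_levy_exp_line[where M = "exp (r / 2)"])
      show "(\<lambda>y. exp (Complex (1 / 2) y * of_real r)) \<in> borel_measurable borel"
        unfolding Complex_eq by measurable
    qed auto
    show "norm (exp (Complex (1 / 2) y * of_real r) * levy_exp t \<alpha> (Complex (1 / 2) y) * \<i>)
        \<le> exp (r / 2) * exp (- decay_rate * \<bar>y\<bar> powr \<alpha>)" for y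
      using norm_levy_exp_le[of "1/2" y] by (simp add: norm_mult)
  qed (use integrable_decay in simp)
  also have "\<dots> = exp (r / 2) * (LBINT y. exp (- decay_rate * \<bar>y\<bar> powr \<alpha>))"
    by (rule integral_mult_right_zero)
  finally show ?thesis
    by (simp add: stable_levy_eq norm_mult norm_divide levy_mass_def divide_right_mono mult.commute)
qed

lemma norm_moment_le:
  assumes "r > 0"
  shows "norm (of_real (r ^ n / fact n * exp (- r)) * stable_levy (1/2) t \<alpha> r)
      \<le> levy_mass * (r ^ n / fact n * exp (- (r / 2)))"
proof -
  have "norm (of_real (r ^ n / fact n * exp (- r)) * stable_levy (1/2) t \<alpha> r)
      = r ^ n / fact n * exp (- r) * norm (stable_levy (1/2) t \<alpha> r)"
    using assms by (simp add: norm_mult norm_divide norm_power)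
  also have "\<dots> \<le> r ^ n / fact n * exp (- r) * (levy_mass * exp (r / 2))"
    using assms by (intro mult_left_mono norm_stable_levy_le) auto
  also have "\<dots> = levy_mass * (r ^ n / fact n * (exp (- r) * exp (r / 2)))" by simp
  also have "exp (- r) * exp (r / 2) = exp (- (r / 2))" by (simp add: exp_add[symmetric])
  finally show ?thesis .
qed

lemma set_integrable_moment:
  "set_integrable lborel {0<..} (\<lambda>r. of_real (r ^ n / fact n * exp (- r)) * stable_levy (1/2) t \<alpha> r)"
proof (rule set_integrable_bound)
  show "set_integrable lborel {0<..} (\<lambda>r. levy_mass * (r ^ n / fact n * exp (- (r / 2))))"
    using laplace_power_half[of n]
    by (intro set_integrable_mult_right) (simp add: set_integrable_def has_bochner_integral_iff)
  show "set_borel_measurable lborel {0<..} (\<lambda>r. of_real (r ^ n / fact n * exp (- r)) * stable_levy (1/2) t \<alpha> r)"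
    unfolding set_borel_measurable_def by measurable
  show "AE r in lborel. r \<in> {0<..} \<longrightarrow> norm (of_real (r ^ n / fact n * exp (- r)) * stable_levy (1/2) t \<alpha> r)
       \<le> norm (levy_mass * (r ^ n / fact n * exp (- (r / 2))))"
    unfolding real_norm_def greaterThan_iff by (intro AE_I2 impI order_trans[OF norm_moment_le abs_ge_self])
qed

text \<open>
  Interchanging the integrations in \<open>r\<close> and along the line turns the weight \<open>r ^ n / n! * exp (- r)\<close>
  into its Laplace transform \<open>1 / (1 - z) ^ (n + 1)\<close>. The double integral converges absolutely since the
  modulus of the integrand is a product of a function of \<open>r\<close> and one of \<open>y\<close>.
\<close>

lemma moment_stable_levy:
  "(LBINT r:{0<..}. of_real (r ^ n / fact n * exp (- r)) * stable_levy (1/2) t \<alpha> r)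
     = exp (- of_real t) * p_poly n (of_real \<alpha>) (of_real t)"
proof -
  define g where "g y = levy_exp t \<alpha> (Complex (1/2) y)" for y
  have [measurable]: "g \<in> borel_measurable borel"
    unfolding g_def[abs_def] by (rule levy_exp_line_measurable) simp
  define F where "F r y = (indicator {0<..} r *\<^sub>R (of_real (r ^ n / fact n) * exp (- (1 - Complex (1/2) y) * of_real r))) * (g y * \<i>)" for r y
  have [measurable]: "case_prod F \<in> borel_measurable (lborel \<Otimes>\<^sub>M lborel)"
    unfolding F_def Complex_eq by measurable
  define a where "a r = indicator {0<..} r * (r ^ n / fact n * exp (- (r / 2)))" for r :: real
  have nF: "norm (F r y) = a r * norm (g y)" for r y
    by (auto simp: F_def a_def norm_mult norm_divide norm_power indicator_def)
  have a_int: "integrable lborel a"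
    using laplace_power_half[of n] by (simp add: a_def[abs_def] has_bochner_integral_iff)
  have g_int: "integrable lborel g"
    using integrable_levy_exp_line[of "1/2" "\<lambda>_. 1" 1] by (simp add: g_def[abs_def])
  have F_int: "integrable (lborel \<Otimes>\<^sub>M lborel) (case_prod F)"
  proof (rule lborel_pair.Fubini_integrable)
    show "integrable lborel (\<lambda>r. LBINT y. norm (case_prod F (r, y)))"
      using a_int by (simp add: nF)
    have "integrable lborel (F r)" for r
    proof (rule Bochner_Integration.integrable_bound)
      show "integrable lborel (\<lambda>y. a r * norm (g y))"
        using g_int by simp
      show "F r \<in> borel_measurable lborel"
        unfolding F_def Complex_eq by measurable
    qed (simp add: nF)
    then show "AE r in lborel. integrable lborel (\<lambda>y. case_prod F (r, y))"
      by simp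
  qed measurable
  have "(LBINT r:{0<..}. of_real (r ^ n / fact n * exp (- r)) * stable_levy (1/2) t \<alpha> r)
      = (LBINT r. 1 / (2 * of_real pi * \<i>) * (LBINT y. F r y))"
    unfolding set_lebesgue_integral_def
  proof (rule Bochner_Integration.integral_cong[OF refl])
    fix r :: real
    have "(LBINT y. F r y) = (LBINT y. (indicator {0<..} r *\<^sub>R of_real (r ^ n / fact n * exp (- r))) *
          (exp (Complex (1/2) y * of_real r) * g y * \<i>))"
    proof (rule Bochner_Integration.integral_cong[OF refl])
      fix y :: real
      have "exp (- (1 - Complex (1/2) y) * of_real r) = exp (- of_real r) * exp (Complex (1/2) y * of_real r)"
        unfolding exp_add[symmetric] by (simp add: algebra_simps)
      then show "F r y = (indicator {0<..} r *\<^sub>R of_real (r ^ n / fact n * exp (- r))) *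
          (exp (Complex (1/2) y * of_real r) * g y * \<i>)"
        by (simp add: F_def exp_of_real[symmetric] mult_ac)
    qed
    also have "\<dots> = (indicator {0<..} r *\<^sub>R of_real (r ^ n / fact n * exp (- r))) *
         vertical_line_integral (1/2) (\<lambda>z. exp (z * of_real r) * levy_exp t \<alpha> z)"
      unfolding vertical_line_integral_def g_def by (rule integral_mult_right_zero)
    finally show "indicator {0<..} r *\<^sub>R (of_real (r ^ n / fact n * exp (- r)) * stable_levy (1/2) t \<alpha> r)
        = 1 / (2 * of_real pi * \<i>) * (LBINT y. F r y)"
      by (simp add: stable_levy_eq)
  qed
  also have "\<dots> = 1 / (2 * of_real pi * \<i>) * (LBINT r. LBINT y. F r y)"
    by (rule integral_mult_right_zero)
  also have "(LBINT r. LBINT y. F r y) = (LBINT y. LBINT r. F r y)"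
    using lborel_pair.Fubini_integral[OF F_int] by simp
  also have "\<dots> = vertical_line_integral (1/2) (\<lambda>z. 1 / (1 - z) ^ Suc n * levy_exp t \<alpha> z)"
    unfolding vertical_line_integral_def
  proof (rule Bochner_Integration.integral_cong[OF refl])
    fix y :: real
    have "(LBINT r. F r y) = (LBINT r:{0<..}. of_real (r ^ n / fact n) * exp (- (1 - Complex (1/2) y) * of_real r)) * (g y * \<i>)"
      unfolding F_def set_lebesgue_integral_def by (rule integral_mult_left_zero)
    also have "\<dots> = 1 / (1 - Complex (1/2) y) ^ Suc n * (g y * \<i>)"
      by (subst laplace_transform_power) auto
    finally show "(LBINT r. F r y) = 1 / (1 - Complex (1/2) y) ^ Suc n * levy_exp t \<alpha> (Complex (1/2) y) * \<i>"
      by (simp only: mult.assoc g_def)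
  qed
  also have "1 / (2 * of_real pi * \<i>) * vertical_line_integral (1/2) (\<lambda>z. 1 / (1 - z) ^ Suc n * levy_exp t \<alpha> z)
      = exp (- of_real t) * p_poly n (of_real \<alpha>) (of_real t)"
    unfolding vertical_integral_levy_exp_over_power by simp
  finally show ?thesis .
qed

text \<open>
  Expanding the Bessel function in powers of \<open>r s\<close> and integrating term by term reduces the claim
  to the moments; the \<open>n\<close>-th term has mass at most a constant times \<open>(2 |s|) ^ n / n!\<close>.
\<close>

lemma bessel_moment_stable_levy:
  fixes s :: complex
  defines "G \<equiv> \<lambda>r. bessel_I0 (2 * csqrt (of_real r * s)) * of_real (exp (- r)) * stable_levy (1/2) t \<alpha> r"
  defines "q \<equiv> \<lambda>n. p_poly n (of_real \<alpha>) (of_real t) * s ^ n / fact n"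
  shows "set_integrable lborel {0<..} G" and "summable q"
    and "(LBINT r:{0<..}. G r) = exp (- of_real t) * (\<Sum>n. q n)"
proof -
  define m where "m n r = of_real (r ^ n / fact n * exp (- r)) * stable_levy (1/2) t \<alpha> r" for n r
  define f where "f n r = s ^ n / fact n * (indicator {0<..} r *\<^sub>R m n r)" for n r
  have m_int: "integrable lborel (\<lambda>r. indicator {0<..} r *\<^sub>R m n r)" for n
    using set_integrable_moment[of n] unfolding set_integrable_def m_def .
  have f_int: "integrable lborel (f n)" for n
    unfolding f_def by (intro integrable_mult_right m_int)
  have f_eq: "f n r = indicator {0<..} r *\<^sub>R ((of_real r * s) ^ n / (fact n)\<^sup>2 * (of_real (exp (- r)) * stable_levy (1/2) t \<alpha> r))" for n r
    by (simp add: f_def m_def power_mult_distrib power2_eq_square)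
  have ser: "summable (\<lambda>n. norm (z ^ n / (fact n)\<^sup>2))" for z :: complex
  proof (rule summable_comparison_test')
    show "summable (\<lambda>n. norm z ^ n / fact n)" using summable_exp[of "norm z"] by (simp add: field_simps)
    show "norm (norm (z ^ n / (fact n)\<^sup>2)) \<le> norm z ^ n / fact n" if "n \<ge> 0" for n
    proof -
      have "fact n * 1 \<le> fact n * (fact n :: real)" by (intro mult_left_mono) auto
      then show ?thesis
        by (auto simp: norm_divide norm_power norm_mult power2_eq_square intro!: divide_left_mono)
    qed
  qed
  have fsum: "summable (\<lambda>n. norm (f n r))" for r
    unfolding f_eq norm_scaleR norm_mult by (intro summable_mult summable_mult2 ser)
  have G: "(\<Sum>n. f n r) = indicator {0<..} r *\<^sub>R G r" for r
  proof -
    have "(\<lambda>n. f n r) sums (indicator {0<..} r *\<^sub>R ((\<Sum>n. (of_real r * s) ^ n / (fact n)\<^sup>2) * (of_real (exp (- r)) * stable_levy (1/2) t \<alpha> r)))"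
      unfolding f_eq by (intro sums_scaleR_right sums_mult2 summable_sums summable_norm_cancel[OF ser])
    then have "(\<Sum>n. f n r) = indicator {0<..} r *\<^sub>R ((\<Sum>n. (of_real r * s) ^ n / (fact n)\<^sup>2) * (of_real (exp (- r)) * stable_levy (1/2) t \<alpha> r))"
      by (rule sums_unique[symmetric])
    also have "(\<Sum>n. (of_real r * s) ^ n / (fact n)\<^sup>2) = bessel_I0 (2 * csqrt (of_real r * s))"
      by (simp add: bessel_I0_def power_mult)
    finally show ?thesis by (simp add: G_def mult.assoc)
  qed
  have mass: "(LBINT r. norm (f n r)) \<le> norm s ^ n / fact n * (levy_mass * 2 ^ Suc n)" for n
  proof -
    let ?a = "\<lambda>r. indicator {0<..} r * (r ^ n / fact n * exp (- (r / 2)))"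
    have "(LBINT r. norm (f n r)) \<le> (LBINT r. norm s ^ n / fact n * (levy_mass * ?a r))"
    proof (rule integral_mono)
      show "integrable lborel (\<lambda>r. norm (f n r))"
        using f_int by (rule integrable_norm)
      show "integrable lborel (\<lambda>r. norm s ^ n / fact n * (levy_mass * ?a r))"
        using laplace_power_half[of n] by (intro integrable_mult_right) (simp add: has_bochner_integral_iff)
      show "norm (f n r) \<le> norm s ^ n / fact n * (levy_mass * ?a r)" for r
      proof -
        have "norm (indicator {0<..} r *\<^sub>R m n r) \<le> levy_mass * ?a r"
          using norm_moment_le[of r n] by (auto simp: m_def indicator_def)
        then have "norm s ^ n / fact n * norm (indicator {0<..} r *\<^sub>R m n r) \<le> norm s ^ n / fact n * (levy_mass * ?a r)"
          by (intro mult_left_mono) auto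
        then show ?thesis
          by (simp only: f_def norm_mult norm_divide norm_power norm_fact)
      qed
    qed
    also have "\<dots> = norm s ^ n / fact n * (levy_mass * 2 ^ Suc n)"
      using has_bochner_integral_integral_eq[OF laplace_power_half[of n]] by (simp only: integral_mult_right_zero)
    finally show ?thesis .
  qed
  have sumint: "summable (\<lambda>n. LBINT r. norm (f n r))"
  proof (rule summable_comparison_test')
    show "summable (\<lambda>n. norm s ^ n / fact n * (levy_mass * 2 ^ Suc n))"
      using summable_mult[OF summable_exp[of "2 * norm s"], of "2 * levy_mass"]
      by (simp add: field_simps power_mult_distrib)
    show "norm (LBINT r. norm (f n r)) \<le> norm s ^ n / fact n * (levy_mass * 2 ^ Suc n)" if "n \<ge> 0" for n
      using mass[of n] by (simp add: integral_nonneg_AE)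
  qed
  have val: "(LBINT r. f n r) = exp (- of_real t) * q n" for n
  proof -
    have "(LBINT r. f n r) = s ^ n / fact n * (LBINT r:{0<..}. m n r)"
      unfolding f_def set_lebesgue_integral_def by (rule integral_mult_right_zero)
    then show ?thesis
      unfolding m_def moment_stable_levy by (simp add: q_def)
  qed
  have AE: "AE r in lborel. summable (\<lambda>n. norm (f n r))" using fsum by simp
  show "set_integrable lborel {0<..} G"
    using integrable_suminf[OF f_int AE sumint] by (simp add: G set_integrable_def)
  have sums: "(\<lambda>n. exp (- of_real t) * q n) sums (LBINT r:{0<..}. G r)"
    using sums_integral[OF f_int AE sumint] by (simp add: G val set_lebesgue_integral_def)
  then have "summable (\<lambda>n. exp (- of_real t) * q n)" by (rule sums_summable)
  then show q: "summable q" by (simp add: summable_mult_D)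
  show "(LBINT r:{0<..}. G r) = exp (- of_real t) * (\<Sum>n. q n)"
    using sums_unique[OF sums] suminf_mult[OF q] by simp
qed

end

section \<open>Bessel integrals of half-integer order\<close>

text \<open>
  An odd entire primitive of the Gaussian, a multiple of the error function. Oddness converts
  limits in the left half-plane into limits in the right one.
\<close>

lemma gaussian_primitive:
  obtains E :: "complex \<Rightarrow> complex"
  where "\<And>z. (E has_field_derivative exp (- z\<^sup>2)) (at z)" "\<And>z. E (- z) = - E z"
    "((\<lambda>x::real. E (of_real x)) \<longlongrightarrow> of_real (sqrt pi / 2)) at_top"
proof -
  obtain E0 :: "complex \<Rightarrow> complex" where E0: "\<And>z. (E0 has_field_derivative exp (- z\<^sup>2)) (at z)"
  proof (rule holomorphic_convex_primitive'[of UNIV "\<lambda>z. exp (- z\<^sup>2)"])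
    show "(\<lambda>z::complex. exp (- z\<^sup>2)) holomorphic_on UNIV"
      by (intro holomorphic_intros)
  qed auto
  \<comment> \<open>antisymmetrising keeps the derivative, as the Gaussian is even\<close>
  define E where "E z = (E0 z - E0 (- z)) / 2" for z
  have E: "(E has_field_derivative exp (- z\<^sup>2)) (at z)" for z
  proof -
    have "((\<lambda>z. E0 (- z)) has_field_derivative exp (- (- z)\<^sup>2) * (-1)) (at z)"
      by (rule DERIV_chain2[OF E0]) (auto intro!: derivative_eq_intros)
    from DERIV_cdivide[OF DERIV_diff[OF E0 this], of 2] show ?thesis
      unfolding E_def by simp
  qed
  moreover have odd: "E (- z) = - E z" for z
    by (simp add: E_def field_simps)
  moreover have "((\<lambda>x. E (of_real x)) \<longlongrightarrow> of_real (sqrt pi / 2)) at_top"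
  proof -
    let ?g = "\<lambda>x::real. complex_of_real (indicator {0..} x *\<^sub>R exp (- x\<^sup>2))"
    have g: "has_bochner_integral lborel ?g (of_real (sqrt pi / 2))"
      by (rule has_bochner_integral_of_real[OF gaussian_moment_0])
    have "((\<lambda>y. LBINT x. indicator {..y} x *\<^sub>R ?g x) \<longlongrightarrow> (LBINT x. ?g x)) at_top"
      by (rule tendsto_integral_at_top) (use g in \<open>auto simp: has_bochner_integral_iff\<close>)
    then have lim: "((\<lambda>y. LBINT x. indicator {..y} x *\<^sub>R ?g x) \<longlongrightarrow> of_real (sqrt pi / 2)) at_top"
      by (simp only: has_bochner_integral_integral_eq[OF g])
    have "(LBINT x. indicator {..y} x *\<^sub>R ?g x) = E (of_real y)" if "y \<ge> 0" for y
    proof -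
      have "(LBINT x. indicator {..y} x *\<^sub>R ?g x) = (LBINT x:{0..y}. exp (- (complex_of_real x)\<^sup>2))"
        unfolding set_lebesgue_integral_def using that
        by (intro Bochner_Integration.integral_cong) (auto simp: indicator_def exp_of_real[symmetric])
      also have "\<dots> = (LBINT x=ereal 0..ereal y. exp (- (complex_of_real x)\<^sup>2))"
        using that by (simp add: interval_integral_Icc)
      also have "\<dots> = E (of_real y) - E (of_real 0)"
      proof (rule interval_integral_FTC_finite)
        fix x
        show "((\<lambda>x. E (of_real x)) has_vector_derivative exp (- (complex_of_real x)\<^sup>2)) (at x within {min 0 y..max 0 y})"
          using has_vector_derivative_real_field[OF E] has_vector_derivative_at_within by blast
      qed (auto intro!: continuous_intros)
      finally show ?thesis using odd[of 0] by simp
    qed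
    then have "eventually (\<lambda>y. (LBINT x. indicator {..y} x *\<^sub>R ?g x) = E (of_real y)) at_top"
      by (rule eventually_at_top_linorderI[of 0])
    with lim show ?thesis by (rule Lim_transform_eventually)
  qed
  ultimately show ?thesis by (rule that)
qed

text \<open>
  In a closed sector strictly inside \<open>|arg z| < \<pi> / 4\<close> the Gaussian decays like \<open>exp (- c (Re z)\<^sup>2)\<close>
  with \<open>c > 0\<close>, so moving from \<open>w\<close> vertically to the real axis changes the primitive by a null quantity.
\<close>

lemma gaussian_primitive_tendsto_sector:
  fixes E :: "complex \<Rightarrow> complex"
  assumes E: "\<And>z. (E has_field_derivative exp (- z\<^sup>2)) (at z)"
    and lim: "((\<lambda>x. E (of_real x)) \<longlongrightarrow> L) at_top"
    and \<kappa>: "0 \<le> \<kappa>" "\<kappa> < 1"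
    and w: "filterlim (\<lambda>r. Re (w r)) at_top G" "eventually (\<lambda>r. \<bar>Im (w r)\<bar> \<le> \<kappa> * Re (w r)) G"
  shows "((\<lambda>r. E (w r)) \<longlongrightarrow> L) G"
proof -
  define c where "c = 1 - \<kappa>\<^sup>2"
  have c: "c > 0" using \<kappa> by (simp add: c_def abs_square_less_1)
  \<comment> \<open>on the segment from \<open>Re (w r)\<close> to \<open>w r\<close>, \<open>Re (z\<^sup>2) \<ge> c (Re (w r))\<^sup>2\<close>, and its length is at most \<open>Re (w r)\<close>\<close>
  have bound: "norm (E (w r) - E (of_real (Re (w r)))) \<le> exp (- c * (Re (w r))\<^sup>2) * Re (w r)"
    if r: "\<bar>Im (w r)\<bar> \<le> \<kappa> * Re (w r)" "Re (w r) > 0" for r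
  proof -
    let ?a = "Re (w r)" let ?b = "Im (w r)"
    have "norm (E (w r) - E (of_real ?a)) \<le> exp (- c * ?a\<^sup>2) * norm (w r - of_real ?a)"
    proof (rule field_differentiable_bound)
      show "convex (closed_segment (of_real ?a) (w r))" by simp
      fix z assume z: "z \<in> closed_segment (complex_of_real ?a) (w r)"
      show "(E has_field_derivative exp (- z\<^sup>2)) (at z within closed_segment (of_real ?a) (w r))"
        using E has_field_derivative_at_within by blast
      obtain u where u: "0 \<le> u" "u \<le> 1" "z = (1 - u) *\<^sub>R of_real ?a + u *\<^sub>R w r"
        using z by (auto simp: in_segment)
      have re: "Re z = ?a" and im: "Im z = u * ?b" unfolding u(3) by (simp_all add: algebra_simps)
      have "\<bar>Im z\<bar> \<le> 1 * \<bar>?b\<bar>" unfolding im abs_mult using u(1,2) by (intro mult_right_mono; simp)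
      then have "\<bar>Im z\<bar> \<le> \<kappa> * ?a" using r by simp
      then have "(Im z)\<^sup>2 \<le> (\<kappa> * ?a)\<^sup>2" using power_mono[of "\<bar>Im z\<bar>" _ 2] by simp
      then show "norm (exp (- z\<^sup>2)) \<le> exp (- c * ?a\<^sup>2)"
        by (simp add: re c_def power_mult_distrib algebra_simps Re_power2)
    qed auto
    also have "norm (w r - of_real ?a) = \<bar>?b\<bar>"
      by (simp add: cmod_def)
    also have "exp (- c * ?a\<^sup>2) * \<bar>?b\<bar> \<le> exp (- c * ?a\<^sup>2) * ?a"
    proof (intro mult_left_mono)
      have "\<kappa> * ?a \<le> 1 * ?a" using r \<kappa> by (intro mult_right_mono) auto
      then show "\<bar>?b\<bar> \<le> ?a" using r by linarith
    qed simp
    finally show ?thesis .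
  qed
  have "((\<lambda>x. exp (- c * x\<^sup>2) * x) \<longlongrightarrow> 0) at_top"
    using c by real_asymp
  then have "((\<lambda>r. exp (- c * (Re (w r))\<^sup>2) * Re (w r)) \<longlongrightarrow> 0) G"
    by (rule filterlim_compose[OF _ w(1)])
  moreover have "eventually (\<lambda>r. norm (E (w r) - E (of_real (Re (w r)))) \<le> exp (- c * (Re (w r))\<^sup>2) * Re (w r)) G"
    using w(2) filterlim_at_top_dense[THEN iffD1, OF w(1), rule_format, of 0]
    by eventually_elim (rule bound)
  ultimately have "((\<lambda>r. E (w r) - E (of_real (Re (w r)))) \<longlongrightarrow> 0) G"
    by (rule Lim_null_comparison[rotated])
  moreover have "((\<lambda>r. E (of_real (Re (w r)))) \<longlongrightarrow> L) G"
    by (rule filterlim_compose[OF lim w(1)])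
  ultimately show ?thesis using tendsto_add by fastforce
qed

text \<open>
  The integrand with a general exponent in place of \<open>n - 3/2\<close>. Its integral over the half-line is,
  up to elementary factors, a modified Bessel function of the second kind of order \<open>a + 1\<close>.
\<close>

definition bessel_kernel :: "real \<Rightarrow> complex \<Rightarrow> real \<Rightarrow> complex" where
  "bessel_kernel a t r = of_real (r powr a) * exp (- of_real r * (1 + t\<^sup>2 / (4 * (of_real r)\<^sup>2)))"

lemma bessel_kernel_measurable [measurable]: "bessel_kernel a t \<in> borel_measurable borel"
  unfolding bessel_kernel_def by measurable

lemma norm_bessel_kernel:
  assumes "r > 0"
  shows "norm (bessel_kernel a t r) = r powr a * exp (- r) * exp (- (Re (t\<^sup>2) / (4 * r)))"
proof -
  have "- of_real r * (1 + t\<^sup>2 / (4 * (of_real r)\<^sup>2)) = of_real (- r) - t\<^sup>2 / of_real (4 * r)"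
    using assms by (simp add: field_simps power2_eq_square)
  then show ?thesis
    using assms by (simp add: bessel_kernel_def norm_mult exp_add[symmetric] mult.assoc del: of_real_minus of_real_mult)
qed

lemma set_integrable_bessel_kernel:
  assumes "a > -1" "Re (t\<^sup>2) \<ge> 0"
  shows "set_integrable lborel {0<..} (bessel_kernel a t)"
proof (rule set_integrable_bound[OF set_integrable_powr_exp[OF assms(1) zero_less_one, simplified]])
  show "set_borel_measurable lborel {0<..} (bessel_kernel a t)"
    unfolding set_borel_measurable_def by measurable
  show "AE r in lborel. r \<in> {0<..} \<longrightarrow> norm (bessel_kernel a t r) \<le> norm (r powr a * exp (- r))"
    using assms(2) by (auto simp: norm_bessel_kernel abs_mult mult_le_cancel_left1 intro!: divide_nonneg_pos)
qed

text \<open>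
  If \<open>Re (t\<^sup>2) > 0\<close>, the factor \<open>exp (- t\<^sup>2 / (4 r))\<close> gains a power of \<open>r\<close> at the origin, which
  covers the exponent \<open>- 3/2\<close>.
\<close>

lemma set_integrable_bessel_kernel':
  assumes "a > -2" "Re (t\<^sup>2) > 0"
  shows "set_integrable lborel {0<..} (bessel_kernel a t)"
proof (rule set_integrable_bound)
  let ?k = "Re (t\<^sup>2) / 4"
  show "set_integrable lborel {0<..} (\<lambda>r. 1 / ?k * (r powr (a + 1) * exp (- r)))"
    using set_integrable_powr_exp[of "a + 1" 1] assms(1) by (intro set_integrable_mult_right) auto
  show "set_borel_measurable lborel {0<..} (bessel_kernel a t)"
    unfolding set_borel_measurable_def by measurable
  have "norm (bessel_kernel a t r) \<le> 1 / ?k * (r powr (a + 1) * exp (- r))" if r: "r > 0" for r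
  proof -
    have "?k / r \<le> exp (?k / r)"
      using exp_ge_add_one_self[of "?k / r"] by linarith
    then have "exp (- (?k / r)) \<le> r / ?k"
      using assms(2) r by (simp add: exp_minus field_simps)
    then have "r powr a * exp (- r) * exp (- (?k / r)) \<le> r powr a * exp (- r) * (r / ?k)"
      by (intro mult_left_mono) auto
    then show ?thesis
      using r by (simp add: norm_bessel_kernel powr_add mult_ac)
  qed
  then show "AE r in lborel. r \<in> {0<..} \<longrightarrow> norm (bessel_kernel a t r) \<le> norm (1 / ?k * (r powr (a + 1) * exp (- r)))"
    unfolding real_norm_def greaterThan_iff by (intro AE_I2 impI order_trans[OF _ abs_ge_self])
qed

definition bessel_integral :: "real \<Rightarrow> complex \<Rightarrow> complex" where
  "bessel_integral a t = (LBINT r:{0<..}. bessel_kernel a t r)"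

lemma bessel_kernel_deriv:
  assumes "r > 0"
  shows "(bessel_kernel a t has_vector_derivative
     of_real a * bessel_kernel (a - 1) t r - bessel_kernel a t r + t\<^sup>2 / 4 * bessel_kernel (a - 2) t r) (at r)"
proof -
  have 1: "((\<lambda>r. complex_of_real (r powr a)) has_vector_derivative of_real (a * r powr (a - 1))) (at r)"
    using assms by (intro has_vector_derivative_of_real)
      (auto intro!: derivative_eq_intros simp: has_real_derivative_iff_has_vector_derivative[symmetric])
  have "((\<lambda>z. exp (- z * (1 + t\<^sup>2 / (4 * z\<^sup>2)))) has_field_derivative
      exp (- of_real r * (1 + t\<^sup>2 / (4 * (of_real r)\<^sup>2))) * (t\<^sup>2 / (4 * (of_real r)\<^sup>2) - 1)) (at (of_real r))"
    using assms by (auto intro!: derivative_eq_intros) (simp add: field_simps eval_nat_numeral)?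
  from has_vector_derivative_mult[OF 1 has_vector_derivative_real_field[OF this]]
  show ?thesis
    unfolding bessel_kernel_def
    by (rule has_vector_derivative_eq_rhs)
       (use assms in \<open>simp add: powr_diff field_simps eval_nat_numeral\<close>)
qed

lemma bessel_kernel_isCont: "r > 0 \<Longrightarrow> isCont (bessel_kernel a t) r"
  using bessel_kernel_deriv has_vector_derivative_continuous by blast

text \<open>
  Integration by parts: the kernel vanishes at both ends of the half-line. This is the three-term
  recurrence of the modified Bessel functions.
\<close>

lemma bessel_integral_rec:
  assumes "a > 0" "Re (t\<^sup>2) > 0"
  shows "bessel_integral a t = of_real a * bessel_integral (a - 1) t + t\<^sup>2 / 4 * bessel_integral (a - 2) t"
proof -
  note int = set_integrable_bessel_kernel'[OF _ assms(2)]
  let ?f = "\<lambda>r. of_real a * bessel_kernel (a - 1) t r - bessel_kernel a t r + t\<^sup>2 / 4 * bessel_kernel (a - 2) t r"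
  have i: "set_integrable lborel {0<..} (bessel_kernel a t)"
     "set_integrable lborel {0<..} (\<lambda>r. of_real a * bessel_kernel (a - 1) t r)"
     "set_integrable lborel {0<..} (\<lambda>r. t\<^sup>2 / 4 * bessel_kernel (a - 2) t r)"
    using assms(1) by (auto intro!: int set_integrable_mult_right)
  have bd: "norm (bessel_kernel a t r) \<le> r powr a * exp (- r)" if "r > 0" for r
    using assms(2) that by (simp add: norm_bessel_kernel mult_le_cancel_left1 divide_nonneg_pos)
  have "(LBINT r:{0<..}. ?f r) = 0 - 0"
  proof (rule set_integral_FTC_Ioi)
    show "set_integrable lborel {0<..} ?f"
      using i by (intro set_integral_add set_integral_diff)
    show "(bessel_kernel a t has_vector_derivative ?f r) (at r)" if "r > 0" for r
      using that by (rule bessel_kernel_deriv)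
    show "isCont ?f r" if "r > 0" for r
      using that by (intro continuous_intros bessel_kernel_isCont)
    have "((\<lambda>r. r powr a * exp (- r)) \<longlongrightarrow> 0) (at_right 0)" "((\<lambda>r. r powr a * exp (- r)) \<longlongrightarrow> 0) at_top"
      using assms(1) by real_asymp+
    then show "(bessel_kernel a t \<longlongrightarrow> 0) (at_right 0)" "(bessel_kernel a t \<longlongrightarrow> 0) at_top"
      using bd by (auto elim!: Lim_null_comparison[rotated] simp: eventually_at_right_less
          intro: eventually_mono[OF eventually_at_right_less] eventually_mono[OF eventually_gt_at_top[of 0]])
  qed
  moreover have "(LBINT r:{0<..}. ?f r) =
    of_real a * bessel_integral (a - 1) t - bessel_integral a t + t\<^sup>2 / 4 * bessel_integral (a - 2) t"
    using i by (simp add: bessel_integral_def set_integral_add set_integral_diff)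
  ultimately show ?thesis by (simp add: algebra_simps)
qed

text \<open>
  With \<open>q = t / 2\<close> and \<open>w = sqrt r \<plusminus> q / sqrt r\<close> one has \<open>w\<^sup>2 = r + q\<^sup>2 / r \<plusminus> t\<close>. Hence the combination of
  the two kernels with exponents \<open>- 1/2\<close> and \<open>- 3/2\<close> that contains \<open>d w / d r\<close> is an exact derivative of
  the Gaussian primitive at \<open>w\<close>. For both signs \<open>w\<close> leaves along the positive direction as \<open>r \<longlongrightarrow> \<infinity>\<close>; as \<open>r\<close>
  tends to \<open>0\<close> it leaves along \<open>\<plusminus> q\<close>. So one combination has integral \<open>0\<close> and the other a full Gaussian
  integral, and these two linear equations determine both values, for complex \<open>t\<close> as well.
\<close>

lemma bessel_integral_base:
  assumes t: "\<bar>Im t\<bar> < Re t"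
  shows "bessel_integral (-1/2) t = of_real (sqrt pi) * exp (- t)"
    and "t * bessel_integral (-3/2) t = 2 * of_real (sqrt pi) * exp (- t)"
proof -
  define q where "q = t / 2"
  have q: "\<bar>Im q\<bar> < Re q" using t by (simp add: q_def)
  have t2: "Re (t\<^sup>2) > 0"
    using t power_strict_mono[of "\<bar>Im t\<bar>" "Re t" 2] by (simp add: Re_power2)
  obtain E :: "complex \<Rightarrow> complex" where E: "\<And>z. (E has_field_derivative exp (- z\<^sup>2)) (at z)" "\<And>z. E (- z) = - E z"
    "((\<lambda>x::real. E (of_real x)) \<longlongrightarrow> of_real (sqrt pi / 2)) at_top"
    using gaussian_primitive by blast
  \<comment> \<open>a slope strictly between that of \<open>q\<close> and \<open>1\<close>, so that \<open>w\<close> stays in one sector near both ends\<close>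
  define \<kappa> where "\<kappa> = (1 + \<bar>Im q\<bar> / Re q) / 2"
  have \<kappa>: "0 < \<kappa>" "\<kappa> < 1" "\<bar>Im q\<bar> < \<kappa> * Re q"
  proof -
    have *: "0 \<le> \<bar>Im q\<bar> / Re q" "\<bar>Im q\<bar> / Re q < 1"
      using q by (auto simp: field_simps)
    show "0 < \<kappa>" unfolding \<kappa>_def using *(1) by (simp add: add_pos_nonneg)
    show "\<kappa> < 1" unfolding \<kappa>_def using *(2) by simp
    have "\<kappa> * Re q = (Re q + \<bar>Im q\<bar>) / 2"
      using q by (auto simp: \<kappa>_def field_simps)
    then show "\<bar>Im q\<bar> < \<kappa> * Re q"
      using q by (simp only:) simp
  qed
  have at_inf: "((\<lambda>r. E (of_real (sqrt r) + of_real s * q / of_real (sqrt r))) \<longlongrightarrow> of_real (sqrt pi / 2)) at_top" 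
    if "s \<in> {1, -1}" for s
  proof (rule gaussian_primitive_tendsto_sector[OF E(1,3) less_imp_le[OF \<kappa>(1)] \<kappa>(2)])
    have *: "filterlim (\<lambda>r. sqrt r + s * Re q / sqrt r) at_top at_top" 
      "filterlim (\<lambda>r. \<kappa> * (sqrt r + s * Re q / sqrt r) - \<bar>Im q\<bar> / sqrt r) at_top at_top"
      using \<kappa>(1) by real_asymp+
    then show "filterlim (\<lambda>r. Re (of_real (sqrt r) + of_real s * q / of_real (sqrt r))) at_top at_top"
      by simp
    show "\<forall>\<^sub>F r in at_top. \<bar>Im (of_real (sqrt r) + of_real s * q / of_real (sqrt r))\<bar>
       \<le> \<kappa> * Re (of_real (sqrt r) + of_real s * q / of_real (sqrt r))"
      using filterlim_at_top_dense[THEN iffD1, OF *(2), rule_format, of 0] eventually_gt_at_top[of 0]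
      by eventually_elim (use that in \<open>auto simp: abs_mult\<close>)
  qed
  have at_0: "((\<lambda>r. E (q / of_real (sqrt r) + of_real s * of_real (sqrt r))) \<longlongrightarrow> of_real (sqrt pi / 2)) (at_right 0)"
    if "s \<in> {1, -1}" for s
  proof (rule gaussian_primitive_tendsto_sector[OF E(1,3) less_imp_le[OF \<kappa>(1)] \<kappa>(2)])
    have "\<kappa> * Re q - \<bar>Im q\<bar> > 0" using \<kappa> by simp
    then have "filterlim (\<lambda>r. (\<kappa> * Re q - \<bar>Im q\<bar>) / sqrt r + s * \<kappa> * sqrt r) at_top (at_right 0)"
      using that by (auto; real_asymp)
    then have *: "filterlim (\<lambda>r. \<kappa> * (Re q / sqrt r + s * sqrt r) - \<bar>Im q\<bar> / sqrt r) at_top (at_right 0)"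
      by (simp add: field_simps diff_divide_distrib)
    have "Re q > 0" using q by simp
    then show "filterlim (\<lambda>r. Re (q / of_real (sqrt r) + of_real s * of_real (sqrt r))) at_top (at_right 0)"
      using that by (auto; real_asymp)
    show "\<forall>\<^sub>F r in at_right 0. \<bar>Im (q / of_real (sqrt r) + of_real s * of_real (sqrt r))\<bar>
       \<le> \<kappa> * Re (q / of_real (sqrt r) + of_real s * of_real (sqrt r))"
      using filterlim_at_top_dense[THEN iffD1, OF *, rule_format, of 0] eventually_at_right_less[of 0]
      by eventually_elim auto
  qed
  have int: "set_integrable lborel {0<..} (bessel_kernel (-1/2) t)" "set_integrable lborel {0<..} (bessel_kernel (-3/2) t)"
    by (rule set_integrable_bessel_kernel'[OF _ t2]; simp)+
  have main: "exp (- (of_real s * t)) * (bessel_integral (-1/2) t - of_real s * q * bessel_integral (-3/2) t) = 2 * (of_real (sqrt pi / 2) - A)"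
    if s: "s \<in> {1, -1}" and A: "((\<lambda>r. E (of_real (sqrt r) + of_real s * q / of_real (sqrt r))) \<longlongrightarrow> A) (at_right 0)" for s A
  proof -
    let ?f = "\<lambda>r. exp (- (of_real s * t)) / 2 * (bessel_kernel (-1/2) t r - of_real s * q * bessel_kernel (-3/2) t r)"
    have "(LBINT r:{0<..}. ?f r) = of_real (sqrt pi / 2) - A"
    proof (rule set_integral_FTC_Ioi[OF _ _ _ A at_inf[OF s]])
      show "set_integrable lborel {0<..} ?f"
        using int by (intro set_integrable_mult_right set_integral_diff)
      show "isCont ?f r" if "r > 0" for r
        using that by (intro continuous_intros bessel_kernel_isCont)
      fix r :: real assume r: "r > 0"
      define w where "w = complex_of_real (sqrt r)"
      have w: "w\<^sup>2 = of_real r" "w \<noteq> 0" using r by (auto simp: w_def of_real_power[symmetric] simp del: of_real_power)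
      have d1: "((\<lambda>r. complex_of_real (sqrt r)) has_vector_derivative of_real (inverse (sqrt r) / 2)) (at r)"
        using r by (intro has_vector_derivative_of_real)
           (auto intro!: derivative_eq_intros simp: has_real_derivative_iff_has_vector_derivative[symmetric])
      have d2: "((\<lambda>z. E (z + of_real s * q / z)) has_field_derivative
          exp (- (w + of_real s * q / w)\<^sup>2) * (1 - of_real s * q / w\<^sup>2)) (at w)"
        by (rule DERIV_chain2[OF E(1)]) (use w in \<open>auto intro!: derivative_eq_intros simp: power2_eq_square\<close>)
      have d: "((\<lambda>r. E (of_real (sqrt r) + of_real s * q / of_real (sqrt r))) has_vector_derivative
          of_real (inverse (sqrt r) / 2) * (exp (- (w + of_real s * q / w)\<^sup>2) * (1 - of_real s * q / w\<^sup>2))) (at r)"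
        using field_vector_diff_chain_at[OF d1 d2[unfolded w_def]] by (simp add: o_def w_def)
      have ex: "exp (- (w + of_real s * q / w)\<^sup>2) = exp (- (of_real s * t)) * exp (- of_real r * (1 + t\<^sup>2 / (4 * (of_real r)\<^sup>2)))"
      proof -
        have "- (w + of_real s * q / w)\<^sup>2 = - (of_real s * t) + - of_real r * (1 + t\<^sup>2 / (4 * (of_real r)\<^sup>2))"
          using w s by (auto simp: w(1)[symmetric] q_def field_simps power2_eq_square)
        then show ?thesis by (simp only: exp_add)
      qed
      have p: "r powr (-1/2) = inverse (sqrt r)" "r powr (-3/2) = inverse (sqrt r) / r"
      proof -
        show *: "r powr (-1/2) = inverse (sqrt r)"
          using r by (simp add: powr_minus powr_half_sqrt[symmetric] inverse_eq_divide)
        have "r powr (-3/2) = r powr (-1/2 - 1)" by simp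
        then show "r powr (-3/2) = inverse (sqrt r) / r"
          using r by (simp only: powr_diff *) simp
      qed
      show "((\<lambda>r. E (of_real (sqrt r) + of_real s * q / of_real (sqrt r))) has_vector_derivative ?f r) (at r)"
        using d unfolding ex w(1) bessel_kernel_def p
        by (rule has_vector_derivative_eq_rhs) (use r in \<open>simp add: field_simps\<close>)
    qed
    moreover have "(LBINT r:{0<..}. ?f r) =
        exp (- (of_real s * t)) / 2 * (bessel_integral (-1/2) t - of_real s * q * bessel_integral (-3/2) t)"
      using int by (simp add: bessel_integral_def set_integral_diff)
    ultimately have "exp (- (of_real s * t)) / 2 * (bessel_integral (-1/2) t - of_real s * q * bessel_integral (-3/2) t)
        = of_real (sqrt pi / 2) - A"
      by (simp only:)
    then have "2 * (exp (- (of_real s * t)) / 2 * (bessel_integral (-1/2) t - of_real s * q * bessel_integral (-3/2) t))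
        = 2 * (of_real (sqrt pi / 2) - A)"
      by (simp only:)
    then show ?thesis by simp
  qed
  have eq1: "exp (- t) * (bessel_integral (-1/2) t - q * bessel_integral (-3/2) t) = 0"
    using main[of 1 "of_real (sqrt pi / 2)"] at_0[of 1] by (simp add: add.commute)
  have "((\<lambda>r. - E (q / of_real (sqrt r) + of_real (-1) * of_real (sqrt r))) \<longlongrightarrow> - of_real (sqrt pi / 2)) (at_right 0)"
    using at_0[of "-1"] by (intro tendsto_minus) auto
  then have eq2: "exp t * (bessel_integral (-1/2) t + q * bessel_integral (-3/2) t) = 2 * of_real (sqrt pi)"
    using main[of "-1" "- of_real (sqrt pi / 2)"] by (simp add: E(2)[symmetric])
  have "bessel_integral (-1/2) t = q * bessel_integral (-3/2) t" using eq1 by simp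
  then have "exp t * (2 * (q * bessel_integral (-3/2) t)) = 2 * of_real (sqrt pi)"
    using eq2 by (simp only: mult_2)
  then have "exp t * (q * bessel_integral (-3/2) t) = of_real (sqrt pi)"
    by simp
  then have *: "q * bessel_integral (-3/2) t = of_real (sqrt pi) * exp (- t)"
    by (simp add: exp_minus field_simps)
  then show "bessel_integral (-1/2) t = of_real (sqrt pi) * exp (- t)"
    using \<open>bessel_integral (-1/2) t = q * bessel_integral (-3/2) t\<close> by (simp only:)
  show "t * bessel_integral (-3/2) t = 2 * of_real (sqrt pi) * exp (- t)"
    using * by (simp add: q_def)
qed

text \<open>
  The same recurrence as for the integrals, checked on coefficients. Padding the coefficients with
  zeros puts all three polynomials over the common power \<open>t ^ (n + 2 - j)\<close>.
\<close>

lemma reverse_bessel_rec: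
  "reverse_bessel (n + 2) t = of_nat (2 * n + 3) * reverse_bessel (n + 1) t + t\<^sup>2 * reverse_bessel n t"
proof -
  define c where "c m j = (if j \<le> m then bessel_coeff m j else 0)" for m j
  have rb: "t ^ (N - m) * reverse_bessel m t = (\<Sum>j\<le>N. c m j * t ^ (N - j))" if "m \<le> N" for m N
  proof -
    have "reverse_bessel m t = (\<Sum>j=0..m. bessel_coeff m j * t ^ (m - j))"
      unfolding reverse_bessel_def by (subst sum.atLeastAtMost_rev) simp
    then have "t ^ (N - m) * reverse_bessel m t = (\<Sum>j=0..m. c m j * t ^ (N - j))"
      using that by (auto simp: sum_distrib_left c_def mult.left_commute power_add[symmetric] intro!: sum.cong)
    also have "\<dots> = (\<Sum>j\<le>N. c m j * t ^ (N - j))"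
      using that by (intro sum.mono_neutral_left) (auto simp: c_def)
    finally show ?thesis .
  qed
  have c0: "c (n + 2) 0 = c n 0"
    by (simp add: c_def bessel_coeff_def del: fact_Suc)
  have cS: "c (n + 2) (Suc j) = of_nat (2 * n + 3) * c (n + 1) j + c n (Suc j)" if j: "j \<le> n + 1" for j
  proof -
    \<comment> \<open>in this form the linear factors of the factorials cancel against denominators\<close>
    have [simp]: "(fact (Suc k) :: complex) = (of_nat k + 1) * fact k" for k by (simp add: add.commute)
    have [simp]: "1 + complex_of_nat k \<noteq> 0" for k
        by (metis of_nat_Suc of_nat_neq_0)
    have [simp]: "complex_of_nat k + 2 \<noteq> 0" for k
        by (metis of_nat_Suc of_nat_neq_0 add.commute add.assoc one_add_one)
    \<comment> \<open>for \<open>j = n\<close> and \<open>j = n + 1\<close> the last coefficient is one of the padding zeros\<close>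
    consider "j = n + 1" | "j = n" | d where "n = Suc (j + d)"
      using j less_iff_Suc_add[of j n] by (cases "j < n") force+
    then show ?thesis
    proof cases
      case 3
      show ?thesis
        unfolding 3 by (simp add: c_def bessel_coeff_def del: fact_Suc, simp add: divide_simps del: fact_Suc of_nat_Suc)
          (simp add: algebra_simps)
    next
      case 2
      have "2 + complex_of_nat n * 2 = 2 * (1 + complex_of_nat n)" by simp
      then have [simp]: "2 + complex_of_nat n * 2 \<noteq> 0" by (simp only: mult_eq_0_iff) simp
      show ?thesis
        unfolding 2 by (simp add: c_def bessel_coeff_def del: fact_Suc, simp add: divide_simps del: fact_Suc of_nat_Suc)
          (simp add: algebra_simps)
    next
      case 1
      have "8 + complex_of_nat n * 4 = 4 * (complex_of_nat n + 2)" by simp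
      then have [simp]: "8 + complex_of_nat n * 4 \<noteq> 0" by (simp only: mult_eq_0_iff) simp
      show ?thesis
        unfolding 1 by (simp add: c_def bessel_coeff_def del: fact_Suc, simp add: divide_simps del: fact_Suc of_nat_Suc)
          (simp add: algebra_simps)
    qed
  qed
  have "reverse_bessel (n + 2) t = (\<Sum>j\<le>Suc (n + 1). c (n + 2) j * t ^ (n + 2 - j))"
    using rb[of "n + 2" "n + 2"] by simp
  also have "\<dots> = c n 0 * t ^ (n + 2) +
      (\<Sum>j\<le>n + 1. (of_nat (2 * n + 3) * c (n + 1) j + c n (Suc j)) * t ^ (n + 1 - j))"
    by (subst sum.atMost_Suc_shift) (use c0 cS in simp)
  also have "\<dots> = of_nat (2 * n + 3) * (\<Sum>j\<le>n + 1. c (n + 1) j * t ^ (n + 1 - j)) +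
      (c n 0 * t ^ (n + 2) + (\<Sum>j\<le>n + 1. c n (Suc j) * t ^ (n + 1 - j)))"
    by (simp add: sum.distrib sum_distrib_left algebra_simps)
  also have "c n 0 * t ^ (n + 2) + (\<Sum>j\<le>n + 1. c n (Suc j) * t ^ (n + 1 - j)) = (\<Sum>j\<le>Suc (n + 1). c n j * t ^ (n + 2 - j))"
    by (subst sum.atMost_Suc_shift) simp
  finally show ?thesis
    using rb[of "n + 1" "n + 1"] rb[of n "n + 2"] by simp
qed

lemma bessel_integral_open_sector:
  assumes t: "\<bar>Im t\<bar> < Re t"
  shows "bessel_integral (real n - 1/2) t = of_real (sqrt pi) * exp (- t) / 2 ^ n * reverse_bessel n t"
proof (induction n rule: less_induct)
  case (less n)
  have t2: "Re (t\<^sup>2) > 0"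
    using t power_strict_mono[of "\<bar>Im t\<bar>" "Re t" 2] by (simp add: Re_power2)
  consider "n = 0" | "n = 1" | m where "n = m + 2"
    by (metis One_nat_def add_2_eq_Suc' not0_implies_Suc)
  then show ?case
  proof cases
    case 1
    then show ?thesis
      using bessel_integral_base(1)[OF t] by (simp add: reverse_bessel_def bessel_coeff_def)
  next
    case 2
    have "bessel_integral (1/2) t = bessel_integral (-1/2) t / 2 + t / 4 * (t * bessel_integral (-3/2) t)"
      using bessel_integral_rec[of "1/2" t] t2 by (simp add: power2_eq_square)
    also have "\<dots> = of_real (sqrt pi) * exp (- t) / 2 * (1 + t)"
      by (simp only: bessel_integral_base[OF t]) (simp add: field_simps)
    finally show ?thesis
      using 2 by (simp add: reverse_bessel_def bessel_coeff_def)
  next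
    case 3
    have "bessel_integral (real n - 1/2) t = of_real (real m + 3/2) * bessel_integral (real (m + 1) - 1/2) t
        + t\<^sup>2 / 4 * bessel_integral (real m - 1/2) t"
      using bessel_integral_rec[of "real m + 3/2" t] t2 by (simp add: 3 algebra_simps)
    also have "\<dots> = of_real (sqrt pi) * exp (- t) / 2 ^ n * reverse_bessel n t"
    proof -
      have rec: "reverse_bessel n t = of_nat (2 * m + 3) * reverse_bessel (m + 1) t + t\<^sup>2 * reverse_bessel m t"
        unfolding 3 by (rule reverse_bessel_rec)
      have IH: "bessel_integral (real (m + 1) - 1/2) t = of_real (sqrt pi) * exp (- t) / 2 ^ (m + 1) * reverse_bessel (m + 1) t"
        "bessel_integral (real m - 1/2) t = of_real (sqrt pi) * exp (- t) / 2 ^ m * reverse_bessel m t"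
        using less.IH[of "m + 1"] less.IH[of m] by (simp_all only: 3)
      have p: "(2::complex) ^ n = 4 * 2 ^ m" by (simp add: 3)
      show ?thesis
        unfolding rec IH p by (simp add: field_simps)
    qed
    finally show ?thesis .
  qed
qed

text \<open>
  On the boundary rays \<open>Re (t\<^sup>2) = 0\<close>, and the integral with exponent \<open>- 3/2\<close> that starts the recurrence
  need not converge absolutely. The exponents \<open>n - 1/2\<close> are dominated by \<open>r powr (n - 1/2) * exp (- r)\<close> throughout the
  closed sector, so the formula extends by continuity.
\<close>

lemma bessel_integral_closed_sector:
  assumes t: "\<bar>Im t\<bar> \<le> Re t"
  shows "bessel_integral (real n - 1/2) t = of_real (sqrt pi) * exp (- t) / 2 ^ n * reverse_bessel n t"
proof -
  define \<tau> where "\<tau> i = t + of_real (inverse (real (Suc i)))" for i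
  have \<tau>: "\<bar>Im (\<tau> i)\<bar> < Re (\<tau> i)" for i
  proof -
    have "inverse (real (Suc i)) > 0" by simp
    then show ?thesis using t unfolding \<tau>_def plus_complex.sel Re_complex_of_real Im_complex_of_real by linarith
  qed
  have \<tau>2: "Re ((\<tau> i)\<^sup>2) \<ge> 0" for i
    using less_imp_le[OF \<tau>[of i]] power_mono[of "\<bar>Im (\<tau> i)\<bar>" "Re (\<tau> i)" 2] by (simp add: Re_power2)
  have lim: "\<tau> \<longlonglongrightarrow> t"
    unfolding \<tau>_def using tendsto_add[OF tendsto_const tendsto_of_real[OF LIMSEQ_inverse_real_of_nat], of t] by simp
  have "(\<lambda>i. bessel_integral (real n - 1/2) (\<tau> i)) \<longlonglongrightarrow> bessel_integral (real n - 1/2) t"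
    unfolding bessel_integral_def set_lebesgue_integral_def
  proof (rule integral_dominated_convergence)
    show "integrable lborel (\<lambda>r. indicator {0<..} r *\<^sub>R (r powr (real n - 1/2) * exp (- r)))"
      using set_integrable_powr_exp[of "real n - 1/2" 1] unfolding set_integrable_def by simp
    show "AE r in lborel. (\<lambda>i. indicator {0<..} r *\<^sub>R bessel_kernel (real n - 1/2) (\<tau> i) r)
          \<longlonglongrightarrow> indicator {0<..} r *\<^sub>R bessel_kernel (real n - 1/2) t r"
      unfolding bessel_kernel_def by (intro AE_I2) (auto simp: indicator_def intro!: tendsto_intros lim)
    show "AE r in lborel. norm (indicator {0<..} r *\<^sub>R bessel_kernel (real n - 1/2) (\<tau> i) r)
        \<le> indicator {0<..} r *\<^sub>R (r powr (real n - 1/2) * exp (- r))" for i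
      using \<tau>2[of i] by (intro AE_I2) (auto simp: indicator_def norm_bessel_kernel mult_le_cancel_left1)
  qed measurable
  moreover have "(\<lambda>i. bessel_integral (real n - 1/2) (\<tau> i))
      \<longlonglongrightarrow> of_real (sqrt pi) * exp (- t) / 2 ^ n * reverse_bessel n t"
    unfolding bessel_integral_open_sector[OF \<tau>] reverse_bessel_def
    by (intro tendsto_intros lim) simp
  ultimately show ?thesis by (rule LIMSEQ_unique)
qed

section \<open>Moments, generating function and Bessel integrals\<close>

theorem corollary4p4:
  fixes \<alpha> \<sigma> :: real
  assumes "0 < \<alpha>" and "\<alpha> < 1" and "0 < \<sigma>"
  shows
    "(\<forall>(t::real) (n::nat). 0 < t \<longrightarrow>
        set_integrable lborel {0<..}
          (\<lambda>r. of_real (r ^ n / fact n * exp (- r)) * stable_levy \<sigma> t \<alpha> r) \<and>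
        (LBINT r:{0<..}. of_real (r ^ n / fact n * exp (- r)) * stable_levy \<sigma> t \<alpha> r) =
          exp (- of_real t) * p_poly n (of_real \<alpha>) (of_real t)) \<and>
     (\<forall>(t::real) (s::complex). 0 < t \<longrightarrow>
        set_integrable lborel {0<..}
          (\<lambda>r. bessel_I0 (2 * csqrt (of_real r * s)) * of_real (exp (- r)) * stable_levy \<sigma> t \<alpha> r) \<and>
        summable (\<lambda>n. p_poly n (of_real \<alpha>) (of_real t) * s ^ n / fact n) \<and>
        (LBINT r:{0<..}. bessel_I0 (2 * csqrt (of_real r * s)) * of_real (exp (- r)) * stable_levy \<sigma> t \<alpha> r) =
          exp (- of_real t) * (\<Sum>n. p_poly n (of_real \<alpha>) (of_real t) * s ^ n / fact n)) \<and>
     (\<forall>(t::real) (n::nat). 0 < t \<longrightarrow> p_poly n (of_real \<alpha>) (of_real t) \<in> \<real>\<^sub>\<ge>\<^sub>0) \<and>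
     (\<forall>(t::complex) (n::nat). 1 \<le> n \<and> \<bar>Im t\<bar> \<le> Re t \<longrightarrow>
        set_integrable lborel {0<..}
          (\<lambda>r. of_real (r powr (real n - 3 / 2)) * exp (- of_real r * (1 + t\<^sup>2 / (4 * (of_real r)\<^sup>2)))) \<and>
        1 / of_real (sqrt pi) *
          (LBINT r:{0<..}. of_real (r powr (real n - 3 / 2)) *
             exp (- of_real r * (1 + t\<^sup>2 / (4 * (of_real r)\<^sup>2)))) =
          exp (- t) / 2 ^ (n - 1) * reverse_bessel (n - 1) t)"
proof (intro conjI allI impI)
  fix t :: real and n :: nat
  assume t: "0 < t"
  have eq: "stable_levy \<sigma> t \<alpha> = stable_levy (1/2) t \<alpha>"
    by (rule ext, rule stable_levy_abscissa_indep) (use assms t in auto)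
  show "set_integrable lborel {0<..} (\<lambda>r. of_real (r ^ n / fact n * exp (- r)) * stable_levy \<sigma> t \<alpha> r)"
    unfolding eq by (rule set_integrable_moment[OF assms(1,2) t])
  show "(LBINT r:{0<..}. of_real (r ^ n / fact n * exp (- r)) * stable_levy \<sigma> t \<alpha> r) =
          exp (- of_real t) * p_poly n (of_real \<alpha>) (of_real t)"
    unfolding eq by (rule moment_stable_levy[OF assms(1,2) t])
next
  fix t :: real and s :: complex
  assume t: "0 < t"
  have eq: "stable_levy \<sigma> t \<alpha> = stable_levy (1/2) t \<alpha>"
    by (rule ext, rule stable_levy_abscissa_indep) (use assms t in auto)
  note bm = bessel_moment_stable_levy[OF assms(1,2) t, of s]
  show "set_integrable lborel {0<..}
          (\<lambda>r. bessel_I0 (2 * csqrt (of_real r * s)) * of_real (exp (- r)) * stable_levy \<sigma> t \<alpha> r)"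
    unfolding eq by (rule bm(1))
  show "summable (\<lambda>n. p_poly n (of_real \<alpha>) (of_real t) * s ^ n / fact n)"
    by (rule bm(2))
  show "(LBINT r:{0<..}. bessel_I0 (2 * csqrt (of_real r * s)) * of_real (exp (- r)) * stable_levy \<sigma> t \<alpha> r) =
          exp (- of_real t) * (\<Sum>n. p_poly n (of_real \<alpha>) (of_real t) * s ^ n / fact n)"
    unfolding eq by (rule bm(3))
next
  fix t :: real and n :: nat
  assume "0 < t"
  then show "p_poly n (of_real \<alpha>) (of_real t) \<in> \<real>\<^sub>\<ge>\<^sub>0"
    by (rule p_poly_nonneg[OF assms(1,2)])
next
  fix t :: complex and n :: nat
  assume *: "1 \<le> n \<and> \<bar>Im t\<bar> \<le> Re t"
  then have n: "real n - 3/2 = real (n - 1) - 1/2" by (simp add: of_nat_diff)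
  have "\<bar>Im t\<bar>\<^sup>2 \<le> (Re t)\<^sup>2" using * by (intro power_mono) auto
  then have t2: "Re (t\<^sup>2) \<ge> 0" by (simp add: Re_power2)
  show "set_integrable lborel {0<..}
     (\<lambda>r. of_real (r powr (real n - 3 / 2)) * exp (- of_real r * (1 + t\<^sup>2 / (4 * (of_real r)\<^sup>2))))"
    using set_integrable_bessel_kernel[of "real n - 3/2" t] t2 * by (simp add: bessel_kernel_def[abs_def])
  have "(LBINT r:{0<..}. of_real (r powr (real n - 3 / 2)) *
             exp (- of_real r * (1 + t\<^sup>2 / (4 * (of_real r)\<^sup>2)))) = bessel_integral (real (n - 1) - 1/2) t"
    unfolding bessel_integral_def bessel_kernel_def n by simp
  also have "\<dots> = of_real (sqrt pi) * exp (- t) / 2 ^ (n - 1) * reverse_bessel (n - 1) t"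
    using * by (intro bessel_integral_closed_sector) simp
  finally show "1 / of_real (sqrt pi) *
          (LBINT r:{0<..}. of_real (r powr (real n - 3 / 2)) *
             exp (- of_real r * (1 + t\<^sup>2 / (4 * (of_real r)\<^sup>2)))) =
          exp (- t) / 2 ^ (n - 1) * reverse_bessel (n - 1) t"
    by simp
qed

end
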